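(* Let $z_0\in\mathbb{C}\setminus\Sigma(\mathcal{L})$ and $R>0$ be fixed, so that no pole of $\mathcal{S}$ lies on $\partial\mathcal{B}(z_0,R)$. Let $\overline{N}\in\mathbb{N}$ be the number of poles of $\mathcal{S}$ within $\mathcal{B}(z_0,R)$. Consider a sequence $(M_k,N_k)_{k=1}^\infty\subset\{(M,N)\in\mathbb{N}^2:\ M\geq N-1\}$ such that $M_{k+1}>M_k$ and $N_{k+1}\geq N_k$ for all $k$, with $\lim_{k\to\infty}N_k\geq\overline{N}$ (the limit may be $+\infty$). For $k=1,2,\ldots$, let $\mathcal{S}_{[M_k/N_k]}$ be the $[M_k/N_k]$ fast LS-Padé approximant of $\mathcal{S}$ centered at $z_0$, computed with $E=\max\{M_k,N_k\}$. Then, for any $\varepsilon>0$, $$\lim_{k\to\infty}\left|\left\{z\in\mathcal{B}(z_0,R)\;:\;\left\|\mathcal{S}(z)-\mathcal{S}_{[M_k/N_k]}(z)\right\|_V>\varepsilon\right\}\right|=0,$$ with $|A|$ denoting the Lebesgue measure of the set $A\subset\mathbb{C}$.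
   Context: Setting. $(V,\langle\cdot,\cdot\rangle_V)$ is a separable Hilbert space over $\mathbb{C}$ with induced norm $\|\cdot\|_V$. $\mathcal{L}:D(\mathcal{L})\subset V\to V$ is a bijective linear operator with dense domain $D(\mathcal{L})$, whose inverse $\mathcal{L}^{-1}:V\to V$ is compact and normal. $\Sigma(\mathcal{L})=\{\lambda\in\mathbb{C}:\exists v\in D(\mathcal{L})\setminus\{0\},\ \mathcal{L}v=\lambda v\}$ is its spectrum, and for $\lambda\in\Sigma(\mathcal{L})$, $P_\lambda$ is the $V$-orthogonal projection onto the eigenspace $\{v\in D(\mathcal{L}):\mathcal{L}v=\lambda v\}$. Fix $v^\star\in V$. For $z\in\mathbb{C}\setminus\Sigma(\mathcal{L})$, $\mathcal{S}(z)\in D(\mathcal{L})$ is the unique solution of $(\mathcal{L}-z\mathcal{I})\mathcal{S}(z)=v^\star$, where $\mathcal{I}$ is the identity; $\mathcal{S}$ is a meromorphic $V$-valued map and $\mathcal{S}(z)=\sum_{\lambda\in\Sigma(\mathcal{L})}\frac{P_\lambda v^\star}{\lambda-z}$. Standing assumptions. $\Sigma(\mathcal{L})$ is infinite (its only limit point is then $\infty$); $P_\lambda v^\star\neq0$ for all $\lambda\in\Sigma(\mathcal{L})$, so the poles of $\mathcal{S}$ are exactly the elements of $\Sigma(\mathcal{L})$. Notation. $\mathcal{B}(z_0,R)=\{z\in\mathbb{C}:|z-z_0|<R\}$. For a function $F$ analytic near $z_0$ (scalar- or $V$-valued), $(F)_{\alpha,z_0}=\frac{1}{\alpha!}\frac{d^\alpha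 F}{dz^\alpha}(z_0)$ is its $\alpha$-th Taylor coefficient at $z_0$. $\mathbb{P}_N^{z_0}(\mathbb{C})$ is the set of polynomials $Q(z)=\sum_{j=0}^Nq_j(z-z_0)^j$ with $q_j\in\mathbb{C}$ and $\sum_{j=0}^N|q_j|^2=1$. The functional $\widetilde{j}_E:\mathbb{P}_N^{z_0}(\mathbb{C})\to[0,\infty)$ is $\widetilde{j}_E(Q)=\|(Q\mathcal{S})_{E,z_0}\|_V$. Fast LS-Padé approximant. For $E\geq\max\{M,N\}$, an $[M/N]$ fast LS-Padé approximant of $\mathcal{S}$ centered at $z_0$ with parameter $E$ is $\mathcal{S}_{[M/N]}=\mathcal{P}_{[M/N]}/Q_{[M/N]}$, where $Q_{[M/N]}\in\mathbb{P}_N^{z_0}(\mathbb{C})$ is a global minimizer of $\widetilde{j}_E$ and $\mathcal{P}_{[M/N]}(z)=\sum_{\alpha=0}^M(Q_{[M/N]}\mathcal{S})_{\alpha,z_0}(z-z_0)^\alpha$. The finitely many points of $\mathcal{B}(z_0,R)$ at which $\mathcal{S}$ or $\mathcal{S}_{[M_k/N_k]}$ is undefined form a Lebesgue-null set and may be included in or excluded from the set in the claim. *)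

theory Defs
  imports "HOL-Complex_Analysis.Complex_Analysis"
begin

section \<open>Complex Hilbert spaces\<close>

class scaleC =
  fixes scaleC :: "complex \<Rightarrow> 'a \<Rightarrow> 'a" (infixr "*\<^sub>C" 75)

text \<open>
  A complex inner product space is presented on top of its underlying real inner product space,
  whose inner product is the real part of the complex one. Since a real inner product space has
  norm \<open>sqrt (inner x x)\<close>, the norm is the one induced by \<open>cinner\<close>. The inner product is linear in
  its first argument.
\<close>
class complex_inner = real_inner + scaleC +
  fixes cinner :: "'a \<Rightarrow> 'a \<Rightarrow> complex"
  assumes scaleC_add_right: "a *\<^sub>C (x + y) = a *\<^sub>C x + a *\<^sub>C y"
    and scaleC_add_left: "(a + b) *\<^sub>C x = a *\<^sub>C x + b *\<^sub>C x"
    and scaleC_scaleC: "a *\<^sub>C b *\<^sub>C x = (a * b) *\<^sub>C x"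
    and scaleR_scaleC: "r *\<^sub>R x = complex_of_real r *\<^sub>C x"
    and cinner_add_left: "cinner (x + y) w = cinner x w + cinner y w"
    and cinner_scaleC_left: "cinner (a *\<^sub>C x) y = a * cinner x y"
    and cinner_commute: "cinner x y = cnj (cinner y x)"
    and inner_eq_Re_cinner: "inner x y = Re (cinner x y)"

class complex_hilbert_space = complex_inner + complete_space

lemma scaleC_one: "1 *\<^sub>C x = (x :: 'a::complex_inner)"
  using scaleR_scaleC[of 1 x] by simp

lemma module_scaleC: "module (scaleC :: complex \<Rightarrow> 'a \<Rightarrow> 'a::complex_inner)"
  by unfold_locales (simp_all add: scaleC_add_right scaleC_add_left scaleC_scaleC scaleC_one)


section \<open>Operators\<close>

text \<open>A possibly unbounded operator is a total function \<open>L\<close> together with its domain \<open>D\<close>; the values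
  of \<open>L\<close> outside \<open>D\<close> are irrelevant.\<close>

definition csubspace :: "'a::complex_inner set \<Rightarrow> bool" where
  "csubspace D \<longleftrightarrow> module.subspace scaleC D"

definition clinear_on :: "'a::complex_inner set \<Rightarrow> ('a \<Rightarrow> 'b::complex_inner) \<Rightarrow> bool" where
  "clinear_on D L \<longleftrightarrow>
     csubspace D \<and>
     (\<forall>x\<in>D. \<forall>y\<in>D. L (x + y) = L x + L y) \<and>
     (\<forall>a. \<forall>x\<in>D. L (a *\<^sub>C x) = a *\<^sub>C L x)"

definition compact_operator :: "('a::complex_inner \<Rightarrow> 'b::complex_inner) \<Rightarrow> bool" where
  "compact_operator T \<longleftrightarrow>
     clinear_on UNIV T \<and> (\<forall>B. bounded B \<longrightarrow> compact (closure (T ` B)))"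

definition is_cadjoint :: "('a::complex_inner \<Rightarrow> 'a) \<Rightarrow> ('a \<Rightarrow> 'a) \<Rightarrow> bool" where
  "is_cadjoint T T' \<longleftrightarrow> (\<forall>x y. cinner (T x) y = cinner x (T' y))"

definition normal_operator :: "('a::complex_inner \<Rightarrow> 'a) \<Rightarrow> bool" where
  "normal_operator T \<longleftrightarrow>
     clinear_on UNIV T \<and> bounded_linear T \<and> (\<exists>T'. is_cadjoint T T' \<and> T \<circ> T' = T' \<circ> T)"

definition eigenspace :: "'a::complex_inner set \<Rightarrow> ('a \<Rightarrow> 'a) \<Rightarrow> complex \<Rightarrow> 'a set" where
  "eigenspace D L l = {v \<in> D. L v = l *\<^sub>C v}"

definition op_spectrum :: "'a::complex_inner set \<Rightarrow> ('a \<Rightarrow> 'a) \<Rightarrow> complex set" where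
  "op_spectrum D L = {l. \<exists>v \<in> D - {0}. L v = l *\<^sub>C v}"

definition orth_proj :: "'a::complex_inner set \<Rightarrow> 'a \<Rightarrow> 'a" where
  "orth_proj W v = (THE p. p \<in> W \<and> (\<forall>w\<in>W. cinner (v - p) w = 0))"

text \<open>The solution map of the shifted problem \<open>(L - z) u = v\<close>; its value is unspecified for \<open>z\<close> in the spectrum.\<close>
definition resolvent_map :: "'a::complex_inner set \<Rightarrow> ('a \<Rightarrow> 'a) \<Rightarrow> 'a \<Rightarrow> complex \<Rightarrow> 'a" where
  "resolvent_map D L v z = (THE u. u \<in> D \<and> L u - z *\<^sub>C u = v)"


section \<open>Taylor coefficients of vector-valued functions\<close>

definition vderiv :: "(complex \<Rightarrow> 'a::complex_inner) \<Rightarrow> complex \<Rightarrow> 'a" where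
  "vderiv F z = (SOME F'. (F has_derivative (\<lambda>h. h *\<^sub>C F')) (at z))"

definition taylor_coeff :: "(complex \<Rightarrow> 'a::complex_inner) \<Rightarrow> nat \<Rightarrow> complex \<Rightarrow> 'a" where
  "taylor_coeff F n z0 = (1 / fact n) *\<^sub>C (vderiv ^^ n) F z0"


section \<open>Fast least-squares Pade approximants\<close>

text \<open>Polynomials are represented by the functions they induce on the complex plane.\<close>
definition normalized_polys :: "complex \<Rightarrow> nat \<Rightarrow> (complex \<Rightarrow> complex) set" where
  "normalized_polys z0 N =
     {\<lambda>z. \<Sum>j\<le>N. q j * (z - z0) ^ j | q. (\<Sum>j\<le>N. (cmod (q j))\<^sup>2) = 1}"

definition ls_functional ::
    "(complex \<Rightarrow> 'a::complex_inner) \<Rightarrow> complex \<Rightarrow> nat \<Rightarrow> (complex \<Rightarrow> complex) \<Rightarrow> real" where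
  "ls_functional S z0 E Q = norm (taylor_coeff (\<lambda>z. Q z *\<^sub>C S z) E z0)"

text \<open>\<open>Q\<close> is an admissible denominator of an \<open>[M/N]\<close> approximant of \<open>S\<close> centred at \<open>z0\<close> with
  parameter \<open>E\<close>. Minimizers need not be unique, and different ones may yield different
  approximants.\<close>
definition fast_LS_Pade_denominator ::
    "(complex \<Rightarrow> 'a::complex_inner) \<Rightarrow> complex \<Rightarrow> nat \<Rightarrow> nat \<Rightarrow> nat \<Rightarrow> (complex \<Rightarrow> complex) \<Rightarrow> bool" where
  "fast_LS_Pade_denominator S z0 M N E Q \<longleftrightarrow>
     max M N \<le> E \<and> is_arg_min (ls_functional S z0 E) (\<lambda>P. P \<in> normalized_polys z0 N) Q"

definition fast_LS_Pade_numerator ::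
    "(complex \<Rightarrow> 'a::complex_inner) \<Rightarrow> complex \<Rightarrow> nat \<Rightarrow> (complex \<Rightarrow> complex) \<Rightarrow> complex \<Rightarrow> 'a" where
  "fast_LS_Pade_numerator S z0 M Q z =
     (\<Sum>n\<le>M. (z - z0) ^ n *\<^sub>C taylor_coeff (\<lambda>w. Q w *\<^sub>C S w) n z0)"

text \<open>The approximant with denominator \<open>Q\<close>; only meaningful where \<open>Q z \<noteq> 0\<close>.\<close>
definition fast_LS_Pade ::
    "(complex \<Rightarrow> 'a::complex_inner) \<Rightarrow> complex \<Rightarrow> nat \<Rightarrow> (complex \<Rightarrow> complex) \<Rightarrow> complex \<Rightarrow> 'a" where
  "fast_LS_Pade S z0 M Q z = (1 / Q z) *\<^sub>C fast_LS_Pade_numerator S z0 M Q z"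

end

theory Submission
  imports Defs "HOL-Computational_Algebra.Fundamental_Theorem_Algebra"
begin

text \<open>
  Write \<open>T\<close> for the compact normal inverse of \<open>L\<close>, \<open>G\<^sub>z = T (1 - z T)\<inverse> = (L - z)\<inverse>\<close>, \<open>A = G\<^sub>z\<close> at
  \<open>z = z0\<close>, and \<open>w = z - z0\<close>. The Taylor coefficients of \<open>S\<close> at \<open>z0\<close> are the vectors \<open>A\<^sup>n\<^sup>+\<^sup>1 v\<close>, so
  that for a polynomial \<open>Q = \<Sum> q\<^sub>j w\<^sup>j\<close> the residual minimized by the denominator is
  \<open>d = \<Sum> q\<^sub>j A\<^sup>E\<^sup>-\<^sup>j\<^sup>+\<^sup>1 v\<close>. Three facts combine.

  The remainder is an explicit multiple of the residual (\<open>remainder_formula\<close>, \<open>remainder_bound\<close>).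
  Expanding the resolvent to finite order around \<open>z0\<close> gives
  \<open>Q S - P = w\<^sup>M\<^sup>+\<^sup>1 G\<^sub>z g\<close> with \<open>g = d\<close> if \<open>E = M\<close>, and with \<open>d = A g\<close> if \<open>E = M + 1\<close>, which is what
  happens when \<open>N = M + 1\<close>. Since \<open>G\<^sub>z\<close> is uniformly bounded on compact sets without poles, the
  remainder is at most a constant times \<open>R\<^sup>M\<close> times the norm of \<open>d\<close> there.

  The minimal residual is small (\<open>ls_functional_minimum_bound\<close>). Let \<open>r > R\<close>. As soon as \<open>N\<close> is at
  least the number of poles in the closed disc of radius \<open>r\<close>, the normalized polynomial vanishing at
  these poles is a competitor. It annihilates the components of \<open>v\<close> in the corresponding eigenspaces.
  On the orthogonal complement \<open>T\<close> has a resolvent that is holomorphic near that disc, so Cauchy's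
  inequality bounds what is left by a constant times \<open>r\<^sup>-\<^sup>E\<close>. Hence \<open>|Q|\<close> times the error is
  \<open>O((R/r)\<^sup>M)\<close> away from the poles.

  A normalized denominator is rarely small (\<open>sublevel_set_normalized_poly\<close>). The set of points of the
  disc with \<open>|Q| < (2B)\<^sup>-\<^sup>N\<close> has measure at most a constant over \<open>B\<close>, for all \<open>B \<ge> 1\<close>, with a constant that
  does not depend on the degree \<open>N\<close>; this uniformity matters because \<open>N\<close> may grow as fast as \<open>M\<close>.

  It remains to see that \<open>(R/r)\<^sup>M (2B)\<^sup>N\<close> tends to zero for a suitable \<open>r\<close>. If the degrees stay bounded,
  any \<open>r\<close> slightly larger than \<open>R\<close> will do. If they are unbounded, then every disc is eventually
  admissible, and \<open>r\<close> is taken so large, depending on \<open>B\<close>, that \<open>2BR/r < 1\<close>.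
\<close>

section \<open>Complex inner product spaces\<close>

lemma Im_cinner_self: "Im (cinner x (x :: 'a::complex_inner)) = 0"
proof -
  have "cnj (cinner x x) = cinner x x" by (rule cinner_commute[symmetric])
  hence "Im (cnj (cinner x x)) = Im (cinner x x)" by (rule arg_cong)
  thus ?thesis by simp
qed

lemma inner_scaleC_scaleC:
  fixes x :: "'a::complex_inner"
  shows "inner (a *\<^sub>C x) (a *\<^sub>C x) = (cmod a)\<^sup>2 * inner x x"
proof -
  have "cinner (a *\<^sub>C x) (a *\<^sub>C x) = a * cnj (a * cinner x x)"
    by (metis cinner_commute cinner_scaleC_left)
  also have "\<dots> = (a * cnj a) * cnj (cinner x x)" by simp
  finally show ?thesis
    by (simp add: inner_eq_Re_cinner Im_cinner_self complex_norm_square[symmetric])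
qed

lemma norm_scaleC: "norm (a *\<^sub>C x) = cmod a * norm (x :: 'a::complex_inner)"
  by (simp add: norm_eq_sqrt_inner inner_scaleC_scaleC real_sqrt_mult)

interpretation scaleC: bounded_bilinear "scaleC :: complex \<Rightarrow> 'a \<Rightarrow> 'a::complex_inner"
proof
  show "(r *\<^sub>R a) *\<^sub>C b = r *\<^sub>R a *\<^sub>C b" for r a and b :: 'a
    by (simp add: scaleR_scaleC scaleC_scaleC scaleR_conv_of_real)
  show "a *\<^sub>C (r *\<^sub>R b) = r *\<^sub>R a *\<^sub>C b" for r a and b :: 'a
    by (simp add: scaleR_scaleC scaleC_scaleC mult.commute)
  show "\<exists>K. \<forall>a (b::'a). norm (a *\<^sub>C b) \<le> norm a * norm b * K"
    by (rule exI[of _ 1]) (simp add: norm_scaleC)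
qed (simp_all add: scaleC_add_left scaleC_add_right)

lemma cmod_cinner_le: "cmod (cinner x y) \<le> norm x * norm (y :: 'a::complex_inner)"
proof -
  \<comment> \<open>A phase that makes the inner product real reduces the claim to the real Cauchy-Schwarz inequality.\<close>
  define a where "a = (if cinner x y = 0 then 1 else cnj (sgn (cinner x y)))"
  have a: "cmod a = 1" by (simp add: a_def norm_sgn)
  have "a * cinner x y = complex_of_real (cmod (cinner x y))"
    by (simp add: a_def sgn_eq complex_norm_square[symmetric] field_simps power2_eq_square)
  hence "cmod (cinner x y) = inner (a *\<^sub>C x) y"
    by (simp add: inner_eq_Re_cinner cinner_scaleC_left)
  also have "\<dots> \<le> norm (a *\<^sub>C x) * norm y" by (rule norm_cauchy_schwarz)
  finally show ?thesis by (simp add: norm_scaleC a)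
qed

lemma cinner_add_right: "cinner x (y + z) = cinner x y + cinner x (z :: 'a::complex_inner)"
  by (metis cinner_add_left cinner_commute complex_cnj_add)

lemma cinner_scaleC_right: "cinner x (a *\<^sub>C y) = cnj a * cinner x (y :: 'a::complex_inner)"
  by (metis cinner_scaleC_left cinner_commute complex_cnj_mult)

interpretation cinner: bounded_bilinear "cinner :: 'a::complex_inner \<Rightarrow> 'a \<Rightarrow> complex"
proof
  show "cinner (r *\<^sub>R a) b = r *\<^sub>R cinner a b" for r and a b :: 'a
    by (simp add: scaleR_scaleC cinner_scaleC_left scaleR_conv_of_real)
  show "cinner a (r *\<^sub>R b) = r *\<^sub>R cinner a b" for r and a b :: 'a
    by (simp add: scaleR_scaleC cinner_scaleC_right scaleR_conv_of_real)
  show "\<exists>K. \<forall>a b::'a. norm (cinner a b) \<le> norm a * norm b * K"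
    by (rule exI[of _ 1]) (simp add: cmod_cinner_le)
qed (simp_all add: cinner_add_left cinner_add_right)

declare scaleC.zero_left [simp] scaleC.zero_right [simp] cinner.zero_left [simp] cinner.zero_right [simp]

lemma cinner_self: "cinner x x = complex_of_real ((norm (x :: 'a::complex_inner))\<^sup>2)"
proof (rule complex_eqI)
  show "Re (cinner x x) = Re (complex_of_real ((norm x)\<^sup>2))"
    by (simp add: inner_eq_Re_cinner[symmetric] power2_norm_eq_inner)
  show "Im (cinner x x) = Im (complex_of_real ((norm x)\<^sup>2))" by (simp add: Im_cinner_self)
qed

lemma cinner_self_eq_0 [simp]: "cinner x x = 0 \<longleftrightarrow> x = (0 :: 'a::complex_inner)"
  by (simp add: cinner_self)

lemma cinner_ext: "(\<And>z. cinner z x = cinner z y) \<Longrightarrow> x = (y :: 'a::complex_inner)"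
  by (metis cinner.diff_right cinner_self_eq_0 right_minus_eq)

lemma cinner_eq_0_commute: "cinner x y = 0 \<longleftrightarrow> cinner y (x :: 'a::complex_inner) = 0"
  by (metis cinner_commute complex_cnj_zero)

lemma norm_le_of_cinner_le:
  assumes "\<And>x. cmod (cinner y x) \<le> C * norm (x :: 'a::complex_inner)" and "C \<ge> 0"
  shows "norm y \<le> C"
proof (cases "y = 0")
  case False
  have "norm y * norm y \<le> C * norm y"
    using assms(1)[of y] by (simp add: cinner_self power2_eq_square norm_mult)
  with False show ?thesis by simp
qed (use assms(2) in simp)

lemma csubspace_simps:
  assumes "csubspace W"
  shows csubspace_0: "0 \<in> W"
    and csubspace_add: "x \<in> W \<Longrightarrow> y \<in> W \<Longrightarrow> x + y \<in> W"
    and csubspace_scaleC: "x \<in> W \<Longrightarrow> a *\<^sub>C x \<in> W"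
    and csubspace_diff: "x \<in> W \<Longrightarrow> y \<in> W \<Longrightarrow> x - y \<in> W"
  using assms unfolding csubspace_def
  by (simp_all add: module.subspace_0[OF module_scaleC] module.subspace_add[OF module_scaleC]
      module.subspace_scale[OF module_scaleC] module.subspace_diff[OF module_scaleC])

lemma csubspaceI:
  assumes "0 \<in> W" "\<And>x y. x \<in> W \<Longrightarrow> y \<in> W \<Longrightarrow> x + y \<in> W" "\<And>a x. x \<in> W \<Longrightarrow> a *\<^sub>C x \<in> W"
  shows "csubspace W"
  using assms unfolding csubspace_def module.subspace_def[OF module_scaleC] by auto

section \<open>Orthogonal projections\<close>

text \<open>A minimizing sequence is Cauchy by the parallelogram law.\<close>
lemma closed_csubspace_nearest_point:
  fixes W :: "'a::complex_hilbert_space set"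
  assumes W: "csubspace W" "closed W"
  obtains p where "p \<in> W" "\<And>w. w \<in> W \<Longrightarrow> norm (x - p) \<le> norm (x - w)"
proof -
  define d where "d = Inf ((\<lambda>w. (norm (x - w))\<^sup>2) ` W)"
  have bdd: "bdd_below ((\<lambda>w. (norm (x - w))\<^sup>2) ` W)" by (rule bdd_belowI[of _ 0]) auto
  have ne: "(\<lambda>w. (norm (x - w))\<^sup>2) ` W \<noteq> {}" using csubspace_0[OF W(1)] by blast
  have d_le: "d \<le> (norm (x - w))\<^sup>2" if "w \<in> W" for w
    unfolding d_def using bdd that by (intro cInf_lower) auto
  have "\<exists>w\<in>W. (norm (x - w))\<^sup>2 < d + 1 / Suc n" for n
    using cInf_lessD[OF ne, of "d + 1 / Suc n"] unfolding d_def by auto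
  then obtain w where w: "\<And>n. w n \<in> W" and wd: "\<And>n. (norm (x - w n))\<^sup>2 < d + 1 / Suc n"
    by metis
  have mid: "(1/2::real) *\<^sub>R (w m + w n) \<in> W" for m n
    using w csubspace_add[OF W(1)] csubspace_scaleC[OF W(1)] by (simp add: scaleR_scaleC)
  have dist: "(norm (w m - w n))\<^sup>2 \<le> 2 * (1 / Suc m + 1 / Suc n)" for m n
  proof -
    have "(norm (w m - w n))\<^sup>2 = 2 * (norm (x - w m))\<^sup>2 + 2 * (norm (x - w n))\<^sup>2
        - 4 * (norm (x - (1/2::real) *\<^sub>R (w m + w n)))\<^sup>2"
      by (simp add: power2_norm_eq_inner inner_simps inner_commute algebra_simps)
    also have "\<dots> \<le> 2 * (d + 1 / Suc m) + 2 * (d + 1 / Suc n) - 4 * d"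
      using wd[of m] wd[of n] d_le[OF mid, of m n]
      by (smt (verit))
    finally show ?thesis by simp
  qed
  have "Cauchy w"
  proof (rule CauchyI)
    fix e :: real assume e: "e > 0"
    obtain k :: nat where k: "4 / e\<^sup>2 < k" using reals_Archimedean2 by blast
    have k0: "0 < real k" using k e by (smt (verit) divide_nonneg_pos zero_less_power)
    have "norm (w m - w n) < e" if mn: "k \<le> m" "k \<le> n" for m n
    proof -
      have "1 / real (Suc m) \<le> 1 / k" "1 / real (Suc n) \<le> 1 / k"
        using mn k0 by (auto intro!: divide_left_mono)
      hence "(norm (w m - w n))\<^sup>2 \<le> 4 / k" using dist[of m n] by simp
      also have "\<dots> < e\<^sup>2" using k k0 e by (simp add: field_simps)
      finally show ?thesis using e by (simp add: power2_less_imp_less)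
    qed
    thus "\<exists>K. \<forall>m\<ge>K. \<forall>n\<ge>K. norm (w m - w n) < e" by blast
  qed
  then obtain p where p: "w \<longlonglongrightarrow> p" by (auto simp: Cauchy_convergent_iff convergent_def)
  have pW: "p \<in> W" using W(2) w p by (metis closed_sequential_limits)
  have "(\<lambda>n. (norm (x - w n))\<^sup>2) \<longlonglongrightarrow> (norm (x - p))\<^sup>2" by (intro tendsto_intros p)
  moreover have "(\<lambda>n. d + 1 / Suc n) \<longlonglongrightarrow> d + 0" by (intro tendsto_intros lim_1_over_n LIMSEQ_Suc)
  ultimately have le_d: "(norm (x - p))\<^sup>2 \<le> d + 0"
    by (rule LIMSEQ_le) (use wd in \<open>auto intro: less_imp_le\<close>)
  have "norm (x - p) \<le> norm (x - v)" if "v \<in> W" for v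
    using power2_le_imp_le[OF order_trans[OF le_d] norm_ge_zero] d_le[OF that] by simp
  with pW show ?thesis using that by blast
qed

text \<open>The nearest point is the foot of the perpendicular. Minimality first gives orthogonality for the
  real inner product; applying this to \<open>\<i> w\<close> as well gives it for the complex one.\<close>
lemma closed_csubspace_projection:
  fixes W :: "'a::complex_hilbert_space set"
  assumes W: "csubspace W" "closed W"
  shows "\<exists>!p. p \<in> W \<and> (\<forall>w\<in>W. cinner (x - p) w = 0)"
proof -
  obtain p where p: "p \<in> W" and min: "\<And>w. w \<in> W \<Longrightarrow> norm (x - p) \<le> norm (x - w)"
    using closed_csubspace_nearest_point[OF W] by metis
  have re: "inner (x - p) w = 0" if w: "w \<in> W" for w
  proof (cases "w = 0")
    case False
    \<comment> \<open>The value of \<open>t\<close> for which \<open>p + t w\<close> is closest to \<open>x\<close>.\<close>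
    define t where "t = inner (x - p) w / (norm w)\<^sup>2"
    have "p + t *\<^sub>R w \<in> W" using p w W(1)
      by (simp add: scaleR_scaleC csubspace_add csubspace_scaleC)
    hence "(norm (x - p))\<^sup>2 \<le> (norm (x - (p + t *\<^sub>R w)))\<^sup>2" using min by (simp add: power_mono)
    also have "\<dots> = (norm (x - p))\<^sup>2 - 2 * t * inner (x - p) w + t\<^sup>2 * (norm w)\<^sup>2"
      unfolding power2_norm_eq_inner
      by (simp add: inner_simps inner_commute algebra_simps power2_eq_square)
    also have "t\<^sup>2 * (norm w)\<^sup>2 = t * inner (x - p) w"
      using False by (simp add: t_def power2_eq_square)
    finally have "t * inner (x - p) w \<le> 0" by simp
    moreover have "t * inner (x - p) w = (inner (x - p) w / norm w)\<^sup>2"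
      by (simp add: t_def power2_eq_square)
    ultimately show ?thesis using False by simp
  qed simp
  have orth: "cinner (x - p) w = 0" if w: "w \<in> W" for w
  proof (rule complex_eqI)
    show "Re (cinner (x - p) w) = Re 0" using re[OF w] by (simp add: inner_eq_Re_cinner)
    have "inner (x - p) (\<i> *\<^sub>C w) = 0" using re w W(1) by (simp add: csubspace_scaleC)
    thus "Im (cinner (x - p) w) = Im 0" by (simp add: inner_eq_Re_cinner cinner_scaleC_right)
  qed
  show ?thesis
  proof (rule ex1I[of _ p])
    show "p \<in> W \<and> (\<forall>w\<in>W. cinner (x - p) w = 0)" using p orth by blast
    fix q assume q: "q \<in> W \<and> (\<forall>w\<in>W. cinner (x - q) w = 0)"
    have d: "q - p \<in> W" using p q csubspace_diff[OF W(1)] by blast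
    have "cinner (q - p) (q - p) = cinner (x - p) (q - p) - cinner (x - q) (q - p)"
      by (simp add: cinner.diff_left)
    also have "\<dots> = 0" using d q orth by simp
    finally show "q = p" by simp
  qed
qed

lemma orth_proj:
  fixes W :: "'a::complex_hilbert_space set"
  assumes "csubspace W" "closed W"
  shows orth_proj_in: "orth_proj W x \<in> W"
    and orth_proj_orthogonal: "w \<in> W \<Longrightarrow> cinner (x - orth_proj W x) w = 0"
    and orth_proj_eqI: "p \<in> W \<Longrightarrow> (\<And>w. w \<in> W \<Longrightarrow> cinner (x - p) w = 0) \<Longrightarrow> orth_proj W x = p"
  using theI'[OF closed_csubspace_projection[OF assms, of x]]
    the1_equality[OF closed_csubspace_projection[OF assms, of x], of p]
  unfolding orth_proj_def by auto

lemma orth_proj_of_mem: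
  fixes W :: "'a::complex_hilbert_space set"
  assumes "csubspace W" "closed W" "x \<in> W"
  shows "orth_proj W x = x"
  by (rule orth_proj_eqI) (use assms in \<open>auto simp: cinner.zero_left\<close>)

lemma orth_proj_add:
  fixes W :: "'a::complex_hilbert_space set"
  assumes W: "csubspace W" "closed W"
  shows "orth_proj W (x + y) = orth_proj W x + orth_proj W y"
proof (rule orth_proj_eqI[OF W])
  fix w assume "w \<in> W"
  thus "cinner (x + y - (orth_proj W x + orth_proj W y)) w = 0"
    using orth_proj_orthogonal[OF W, of w x] orth_proj_orthogonal[OF W, of w y]
    by (simp add: cinner.diff_left cinner.add_left)
qed (use W in \<open>simp add: csubspace_add orth_proj_in\<close>)

lemma orth_proj_diff:
  fixes W :: "'a::complex_hilbert_space set"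
  assumes W: "csubspace W" "closed W"
  shows "orth_proj W (x - y) = orth_proj W x - orth_proj W y"
  using orth_proj_add[OF W, of "x - y" y] by (simp add: algebra_simps)

lemma orth_proj_scaleC:
  fixes W :: "'a::complex_hilbert_space set"
  assumes W: "csubspace W" "closed W"
  shows "orth_proj W (a *\<^sub>C x) = a *\<^sub>C orth_proj W x"
proof (rule orth_proj_eqI[OF W])
  fix w assume "w \<in> W"
  thus "cinner (a *\<^sub>C x - a *\<^sub>C orth_proj W x) w = 0"
    using orth_proj_orthogonal[OF W, of w x] 
    by (simp add: scaleC.diff_right[symmetric] cinner_scaleC_left)
qed (use W in \<open>simp add: csubspace_scaleC orth_proj_in\<close>)

lemma orth_proj_selfadjoint:
  fixes W :: "'a::complex_hilbert_space set"
  assumes W: "csubspace W" "closed W"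
  shows "cinner (orth_proj W x) y = cinner x (orth_proj W y)"
proof -
  have "cinner (orth_proj W x) (y - orth_proj W y) = 0" "cinner (x - orth_proj W x) (orth_proj W y) = 0"
    using orth_proj_orthogonal[OF W] orth_proj_in[OF W] cinner_eq_0_commute by blast+
  thus ?thesis by (simp add: cinner.diff_left cinner.diff_right)
qed

lemma norm_orth_proj_le:
  fixes W :: "'a::complex_hilbert_space set"
  assumes W: "csubspace W" "closed W"
  shows "norm (orth_proj W x) \<le> norm x"
proof -
  have "cinner (orth_proj W x) (orth_proj W x) = cinner x (orth_proj W x)"
    using orth_proj_orthogonal[OF W orth_proj_in[OF W], of x x] by (simp add: cinner.diff_left)
  hence "(norm (orth_proj W x))\<^sup>2 = cmod (cinner x (orth_proj W x))"
    by (metis cinner_self norm_of_real abs_of_nonneg zero_le_power2)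
  also have "\<dots> \<le> norm x * norm (orth_proj W x)" by (rule cmod_cinner_le)
  finally show ?thesis
    by (cases "orth_proj W x = 0") (auto simp: power2_eq_square)
qed

section \<open>Compact normal operators and their resolvents\<close>

text \<open>The characteristic values of \<open>T\<close> are the reciprocals of its nonzero eigenvalues, hence the
  eigenvalues of the inverse of \<open>T\<close> when \<open>T\<close> is injective.\<close>
definition char_values :: "('a::complex_inner \<Rightarrow> 'a) \<Rightarrow> complex set" where
  "char_values T = {z. \<exists>x. x \<noteq> 0 \<and> x = z *\<^sub>C T x}"

text \<open>The operator \<open>G\<^sub>z = T (1 - z T)\<inverse>\<close>. If \<open>T\<close> is invertible this is the resolvent \<open>(T\<inverse> - z)\<inverse>\<close>; the
  present form also makes sense for operators with a kernel, such as the deflation of \<open>T\<close> used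
  below.\<close>
definition inv_resolvent :: "('a::complex_inner \<Rightarrow> 'a) \<Rightarrow> complex \<Rightarrow> 'a \<Rightarrow> 'a" where
  "inv_resolvent T z x = T (THE y. y - z *\<^sub>C T y = x)"

locale compact_normal_operator =
  fixes T :: "'a::complex_hilbert_space \<Rightarrow> 'a"
  assumes compact: "compact_operator T" and normal: "normal_operator T"
begin

lemma bounded_linear: "bounded_linear T"
  using normal by (simp add: normal_operator_def)

lemma scaleC_arg: "T (a *\<^sub>C x) = a *\<^sub>C T x"
  using normal by (simp add: normal_operator_def clinear_on_def)

lemmas add = bounded_linear.linear[OF bounded_linear, THEN linear_add]
  and diff = bounded_linear.linear[OF bounded_linear, THEN linear_diff]
  and zero = bounded_linear.linear[OF bounded_linear, THEN linear_0]

lemma pos_bound: obtains B where "B > 0" "\<And>x. norm (T x) \<le> B * norm x"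
  using bounded_linear.pos_bounded[OF bounded_linear] by (metis mult.commute)

lemma convergent_image_subsequence:
  assumes "\<And>n. norm (x n) \<le> 1"
  obtains t r where "strict_mono (r :: nat \<Rightarrow> nat)" "(\<lambda>n. T (x (r n))) \<longlonglongrightarrow> t"
proof -
  have "compact (closure (T ` cball 0 1))"
    using compact unfolding compact_operator_def by (metis bounded_cball)
  moreover have "T (x n) \<in> closure (T ` cball 0 1)" for n
    using assms[of n] by (intro subsetD[OF closure_subset]) auto
  ultimately obtain t r where "strict_mono (r :: nat \<Rightarrow> nat)" "((\<lambda>n. T (x n)) \<circ> r) \<longlonglongrightarrow> t"
    unfolding compact_eq_seq_compact_metric seq_compact_def by metis
  thus ?thesis using that by (simp add: o_def)
qed

text \<open>Otherwise there are unit vectors \<open>y\<^sub>n\<close> and parameters \<open>z\<^sub>n\<close> in \<open>K\<close> with \<open>y\<^sub>n - z\<^sub>n T y\<^sub>n\<close> tending to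
  zero. By compactness of \<open>K\<close> and of \<open>T\<close>, a subsequence of \<open>z\<^sub>n T y\<^sub>n\<close>, and with it of \<open>y\<^sub>n\<close>, converges,
  and the limit is a unit eigenvector for some parameter in \<open>K\<close>.\<close>
lemma bounded_below:
  assumes "compact K" "K \<inter> char_values T = {}"
  shows "\<exists>c>0. \<forall>z\<in>K. \<forall>x. c * norm x \<le> norm (x - z *\<^sub>C T x)"
proof (rule ccontr)
  assume contra: "\<not> ?thesis"
  have "\<exists>z y. z \<in> K \<and> norm y = 1 \<and> norm (y - z *\<^sub>C T y) < 1 / real (Suc n)" for n
  proof -
    obtain z x where z: "z \<in> K" and x: "norm (x - z *\<^sub>C T x) < 1 / real (Suc n) * norm x"
      using contra by (metis not_le of_nat_0_less_iff zero_less_Suc zero_less_divide_1_iff)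
    have x0: "norm x > 0" using x by (cases "x = 0") (auto simp: zero)
    define y where "y = complex_of_real (1 / norm x) *\<^sub>C x"
    have "y - z *\<^sub>C T y = complex_of_real (1 / norm x) *\<^sub>C (x - z *\<^sub>C T x)"
      by (simp only: y_def scaleC_arg scaleC.diff_right scaleC_scaleC mult.commute)
    hence "norm (y - z *\<^sub>C T y) = norm (x - z *\<^sub>C T x) / norm x"
      by (simp add: norm_scaleC norm_divide)
    also have "\<dots> < 1 / real (Suc n)" using x x0 by (simp add: divide_less_eq)
    finally have "norm (y - z *\<^sub>C T y) < 1 / real (Suc n)" .
    moreover have "norm y = 1" using x0 by (simp add: y_def norm_scaleC norm_divide)
    ultimately show ?thesis using z by blast
  qed
  then obtain Z Y where Z: "\<And>n. Z n \<in> K" and Y: "\<And>n. norm (Y n) = 1"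
    and ZY: "\<And>n. norm (Y n - Z n *\<^sub>C T (Y n)) < 1 / real (Suc n)" by metis
  obtain z r where z: "z \<in> K" "strict_mono r" "(Z \<circ> r) \<longlonglongrightarrow> z"
    using assms(1) Z unfolding compact_eq_seq_compact_metric seq_compact_def by metis
  obtain t s where s: "strict_mono s" "(\<lambda>n. T (Y (r (s n)))) \<longlonglongrightarrow> t"
    using convergent_image_subsequence[of "\<lambda>n. Y (r n)"] Y by (metis order_refl)
  define q where "q = r \<circ> s"
  have q: "strict_mono q" using z s by (simp add: q_def strict_mono_o)
  have Zq: "(\<lambda>n. Z (q n)) \<longlonglongrightarrow> z"
    using LIMSEQ_subseq_LIMSEQ[OF z(3) s(1)] by (simp add: q_def o_def)
  have Tq: "(\<lambda>n. T (Y (q n))) \<longlonglongrightarrow> t" using s(2) by (simp add: q_def)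
  have "(\<lambda>n. Y n - Z n *\<^sub>C T (Y n)) \<longlonglongrightarrow> 0"
    by (rule Lim_null_comparison[OF _ LIMSEQ_Suc[OF lim_1_over_n]])
       (use ZY in \<open>auto intro!: always_eventually less_imp_le\<close>)
  from LIMSEQ_subseq_LIMSEQ[OF this q]
  have "(\<lambda>n. (Y (q n) - Z (q n) *\<^sub>C T (Y (q n))) + Z (q n) *\<^sub>C T (Y (q n))) \<longlonglongrightarrow> 0 + z *\<^sub>C t"
    by (intro tendsto_add scaleC.tendsto Zq Tq) (simp add: o_def)
  hence Yq: "(\<lambda>n. Y (q n)) \<longlonglongrightarrow> z *\<^sub>C t" by simp
  have "(\<lambda>n. T (Y (q n))) \<longlonglongrightarrow> T (z *\<^sub>C t)"
    by (rule bounded_linear.tendsto[OF bounded_linear Yq])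
  hence "T (z *\<^sub>C t) = t" using Tq LIMSEQ_unique by blast
  moreover have "norm (z *\<^sub>C t) = 1"
    using tendsto_norm[OF Yq] Y LIMSEQ_unique[OF tendsto_const[of 1]] by simp
  hence "z *\<^sub>C t \<noteq> 0" by auto
  ultimately have "z \<in> char_values T" unfolding char_values_def by force
  thus False using z(1) assms(2) by blast
qed

definition adj :: "'a \<Rightarrow> 'a" where
  "adj = (SOME T'. is_cadjoint T T' \<and> T \<circ> T' = T' \<circ> T)"

lemma adj_is_cadjoint: "is_cadjoint T adj"
  and adj_comp: "T \<circ> adj = adj \<circ> T"
  using someI_ex[of "\<lambda>T'. is_cadjoint T T' \<and> T \<circ> T' = T' \<circ> T"] normal
  unfolding normal_operator_def adj_def by blast+

lemma adj_commute: "T (adj x) = adj (T x)"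
  using adj_comp by (metis comp_apply)

lemma cinner_adj: "cinner (T x) y = cinner x (adj y)"
  using adj_is_cadjoint by (simp add: is_cadjoint_def)

lemma cinner_adj': "cinner x (T y) = cinner (adj x) y"
  by (metis cinner_adj cinner_commute)

text \<open>In particular \<open>1 - z T\<close> and its adjoint have the same kernel, which is how normality enters both
  the Fredholm alternative and the orthogonality of eigenvectors.\<close>
lemma norm_sub_adj: "norm (x - cnj z *\<^sub>C adj x) = norm (x - z *\<^sub>C T x)"
proof -
  have n: "cinner (adj x) (adj x) = cinner (T x) (T x)"
    by (simp add: cinner_adj cinner_adj'[symmetric] adj_commute)
  have "cinner (x - cnj z *\<^sub>C adj x) (x - cnj z *\<^sub>C adj x)
      = cinner x x - z * cinner x (adj x) - cnj z * cinner (adj x) x + cnj z * z * cinner (adj x) (adj x)"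
    by (simp add: cinner.diff_left cinner.diff_right cinner_scaleC_left cinner_scaleC_right algebra_simps)
  also have "\<dots> = cinner (x - z *\<^sub>C T x) (x - z *\<^sub>C T x)"
    unfolding n cinner_adj[symmetric, of x x] cinner_adj'[symmetric, of x x]
    by (simp add: cinner.diff_left cinner.diff_right cinner_scaleC_left cinner_scaleC_right algebra_simps)
  finally have "(norm (x - cnj z *\<^sub>C adj x))\<^sup>2 = (norm (x - z *\<^sub>C T x))\<^sup>2"
    by (simp only: cinner_self of_real_eq_iff)
  thus ?thesis by simp
qed

lemma adj_fixed_iff: "x = cnj z *\<^sub>C adj x \<longleftrightarrow> x = z *\<^sub>C T x"
  using norm_sub_adj[of x z] by (metis norm_eq_zero right_minus_eq)

text \<open>The Fredholm alternative. The range of \<open>1 - z T\<close> is closed because the operator is bounded below.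
  Its orthogonal complement is the kernel of the adjoint, which for a normal operator is the kernel
  of \<open>1 - z T\<close> itself, and this is trivial.\<close>
lemma ex1_preimage:
  assumes z: "z \<notin> char_values T"
  shows "\<exists>!y. y - z *\<^sub>C T y = x"
proof -
  define F where "F = (\<lambda>y. y - z *\<^sub>C T y)"
  have F: "bounded_linear F"
    unfolding F_def by (intro bounded_linear_sub bounded_linear_ident
      scaleC.bounded_linear_right[THEN bounded_linear_compose] bounded_linear)
  obtain c where c: "c > 0" "\<And>x. c * norm x \<le> norm (F x)"
    using bounded_below[of "{z}"] z by (auto simp: F_def)
  have "complete (range F)"
    by (rule complete_isometric_image[OF c(1) _ F]) (use c in \<open>auto simp: complete_UNIV\<close>)
  hence cl: "closed (range F)" by (rule complete_imp_closed)
  have sub: "csubspace (range F)"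
  proof (rule csubspaceI)
    show "0 \<in> range F" by (rule range_eqI[of _ _ 0]) (simp add: F_def zero)
    show "u + v \<in> range F" if "u \<in> range F" "v \<in> range F" for u v
      using that bounded_linear.linear[OF F] by (metis (no_types) linear_add rangeE rangeI)
    show "a *\<^sub>C u \<in> range F" if "u \<in> range F" for a u
    proof -
      from that obtain w where "u = F w" by blast
      hence "a *\<^sub>C u = F (a *\<^sub>C w)"
        by (simp add: F_def scaleC_arg scaleC.diff_right scaleC_scaleC mult.commute)
      thus ?thesis by simp
    qed
  qed
  define y where "y = x - orth_proj (range F) x"
  have "cinner (F u) y = 0" for u
    using orth_proj_orthogonal[OF sub cl, of "F u" x] unfolding y_def
    by (simp add: cinner_eq_0_commute)
  hence "cinner u y = cinner u (cnj z *\<^sub>C adj y)" for u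
    by (simp add: F_def cinner.diff_left cinner_scaleC_left cinner_scaleC_right cinner_adj)
  hence "y = cnj z *\<^sub>C adj y" by (rule cinner_ext)
  hence "y = z *\<^sub>C T y" by (simp only: adj_fixed_iff)
  hence "y = 0" using z by (auto simp: char_values_def)
  hence "x \<in> range F" using orth_proj_in[OF sub cl, of x] by (simp add: y_def)
  then obtain w where w: "x = F w" by blast
  show ?thesis
  proof (rule ex1I[of _ w])
    show "w - z *\<^sub>C T w = x" using w by (simp add: F_def)
    fix v assume "v - z *\<^sub>C T v = x"
    hence "F v - F w = 0" using w by (simp add: F_def)
    hence "F (v - w) = 0" using linear_diff[OF bounded_linear.linear[OF F]] by simp
    hence "c * norm (v - w) \<le> 0" using c(2)[of "v - w"] by simp
    thus "v = w" using c(1) by (simp add: mult_le_0_iff)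
  qed
qed

lemma inv_resolvent_eqI:
  assumes "z \<notin> char_values T" "y - z *\<^sub>C T y = x"
  shows "inv_resolvent T z x = T y"
  using the1_equality[OF ex1_preimage[OF assms(1)] assms(2)] by (simp add: inv_resolvent_def)

lemma inv_resolvent_cases:
  assumes "z \<notin> char_values T"
  obtains y where "y - z *\<^sub>C T y = x" "inv_resolvent T z x = T y"
  using ex1_preimage[OF assms, of x] inv_resolvent_eqI[OF assms] by metis

lemma inv_resolvent_add:
  assumes z: "z \<notin> char_values T"
  shows "inv_resolvent T z (x + y) = inv_resolvent T z x + inv_resolvent T z y"
proof -
  obtain u v where u: "u - z *\<^sub>C T u = x" "inv_resolvent T z x = T u"
    and v: "v - z *\<^sub>C T v = y" "inv_resolvent T z y = T v" using inv_resolvent_cases[OF z] by metis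
  show ?thesis unfolding u(2) v(2) add[symmetric]
    by (rule inv_resolvent_eqI[OF z]) (simp add: add scaleC.add_right u(1)[symmetric] v(1)[symmetric])
qed

lemma inv_resolvent_scaleC:
  assumes z: "z \<notin> char_values T"
  shows "inv_resolvent T z (a *\<^sub>C x) = a *\<^sub>C inv_resolvent T z x"
proof -
  obtain u where u: "u - z *\<^sub>C T u = x" "inv_resolvent T z x = T u" using inv_resolvent_cases[OF z] by metis
  show ?thesis unfolding u(2) scaleC_arg[symmetric]
    by (rule inv_resolvent_eqI[OF z])
       (simp add: scaleC_arg scaleC.diff_right scaleC_scaleC u(1)[symmetric] mult.commute)
qed

lemma inv_resolvent_uniform_bound:
  assumes "compact K" "K \<inter> char_values T = {}"
  obtains C where "C > 0" "\<And>z x. z \<in> K \<Longrightarrow> norm (inv_resolvent T z x) \<le> C * norm x"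
proof -
  obtain c where c: "c > 0" "\<And>z x. z \<in> K \<Longrightarrow> c * norm x \<le> norm (x - z *\<^sub>C T x)"
    using bounded_below[OF assms] by blast
  obtain B where B: "B > 0" "\<And>x. norm (T x) \<le> B * norm x" using pos_bound by blast
  show ?thesis
  proof (rule that[of "B / c"])
    fix z x assume z: "z \<in> K"
    hence "z \<notin> char_values T" using assms(2) by blast
    then obtain y where y: "y - z *\<^sub>C T y = x" "inv_resolvent T z x = T y" by (rule inv_resolvent_cases)
    have "norm y \<le> norm x / c" using c(2)[OF z, of y] c(1) y(1) by (simp add: field_simps)
    hence "norm (T y) \<le> B * (norm x / c)" using B by (meson mult_left_mono order_trans less_imp_le)
    thus "norm (inv_resolvent T z x) \<le> B / c * norm x" using y by simp
  qed (use B c in simp)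
qed

lemma inv_resolvent_bounded_linear:
  assumes z: "z \<notin> char_values T"
  shows "bounded_linear (inv_resolvent T z)"
proof -
  obtain C where "\<And>x. norm (inv_resolvent T z x) \<le> C * norm x"
    using inv_resolvent_uniform_bound[of "{z}"] z
    by (metis compact_sing disjoint_insert(1) inf_bot_left insertI1 Int_commute)
  thus ?thesis
    by (intro bounded_linear_intro[of _ C])
       (simp_all add: inv_resolvent_add[OF z] inv_resolvent_scaleC[OF z] scaleR_scaleC mult.commute)
qed

lemma resolvent_identity:
  assumes y: "y \<notin> char_values T" and z: "z \<notin> char_values T"
  shows "inv_resolvent T y x = inv_resolvent T z x + (y - z) *\<^sub>C inv_resolvent T z (inv_resolvent T y x)"
proof -
  obtain u where u: "u - y *\<^sub>C T u = x" "inv_resolvent T y x = T u" using inv_resolvent_cases[OF y] by metis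
  have "inv_resolvent T z (x + (y - z) *\<^sub>C T u) = T u"
    by (rule inv_resolvent_eqI[OF z]) (simp add: u(1)[symmetric] scaleC.diff_left)
  thus ?thesis by (simp add: inv_resolvent_add[OF z] inv_resolvent_scaleC[OF z] u(2))
qed

text \<open>If \<open>1 - z T\<close> is bounded below, so is \<open>1 - y T\<close> for \<open>y\<close> close to \<open>z\<close>.\<close>
lemma open_regular: "open (- char_values T)"
  unfolding open_contains_ball
proof
  fix z assume z: "z \<in> - char_values T"
  obtain c where c: "c > 0" "\<And>x. c * norm x \<le> norm (x - z *\<^sub>C T x)"
    using bounded_below[of "{z}"] z by auto
  obtain B where B: "B > 0" "\<And>x. norm (T x) \<le> B * norm x" using pos_bound by blast
  have "y \<notin> char_values T" if y: "cmod (y - z) < c / B" for y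
  proof
    assume "y \<in> char_values T"
    then obtain x where x: "x \<noteq> 0" "x = y *\<^sub>C T x" by (auto simp: char_values_def)
    hence "x - z *\<^sub>C T x = (y - z) *\<^sub>C T x" by (simp add: scaleC.diff_left)
    hence "c * norm x \<le> cmod (y - z) * (B * norm x)"
      using c(2)[of x] B(2)[of x] by (simp add: norm_scaleC) (meson mult_left_mono norm_ge_zero order_trans)
    also have "\<dots> < (c / B) * (B * norm x)" using x(1) B y by (intro mult_strict_right_mono) auto
    finally show False using B by simp
  qed
  thus "\<exists>e>0. ball z e \<subseteq> - char_values T"
    using c(1) B(1) by (intro exI[of _ "c / B"]) (auto simp: dist_norm norm_minus_commute)
qed

lemma char_vectors_orthogonal:
  assumes e: "e = z *\<^sub>C T e" and f: "f = y *\<^sub>C T f" and "z \<noteq> y"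
  shows "cinner e f = 0"
proof (cases "z = 0 \<or> y = 0")
  case True
  with e f show ?thesis by (metis scaleC.zero_left cinner.zero_left cinner.zero_right)
next
  case False
  have "f = cnj y *\<^sub>C adj f" using f adj_fixed_iff by blast
  hence "y * cinner e f = y * (z * cinner (T e) f)" using e by (metis cinner_scaleC_left)
  also have "\<dots> = z * cinner e (cnj y *\<^sub>C adj f)" by (simp add: cinner_scaleC_right cinner_adj)
  also have "\<dots> = z * cinner e f" using \<open>f = cnj y *\<^sub>C adj f\<close> by simp
  finally show ?thesis using assms(3) by simp
qed

text \<open>Infinitely many characteristic values of modulus at most \<open>r\<close> would have orthonormal eigenvectors
  whose images under \<open>T\<close> are pairwise at distance at least \<open>1 / r\<close>, which contradicts compactness.\<close>
lemma finite_char_values: "finite (char_values T \<inter> cball 0 r)"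
proof (rule ccontr)
  assume inf: "infinite (char_values T \<inter> cball 0 r)"
  obtain g :: "nat \<Rightarrow> complex" where g: "inj g" "range g \<subseteq> char_values T \<inter> cball 0 r"
    using infinite_countable_subset[OF inf] by blast
  have "\<exists>e. norm e = 1 \<and> e = g n *\<^sub>C T e" for n
  proof -
    have "g n \<in> char_values T" using g(2) by blast
    then obtain x where x: "x \<noteq> 0" "x = g n *\<^sub>C T x" by (auto simp: char_values_def)
    define a where "a = complex_of_real (1 / norm x)"
    have "norm (a *\<^sub>C x) = 1" using x by (simp add: norm_scaleC norm_divide a_def)
    moreover have "g n *\<^sub>C T (a *\<^sub>C x) = a *\<^sub>C (g n *\<^sub>C T x)"
      by (simp add: scaleC_arg scaleC_scaleC mult.commute)
    hence "a *\<^sub>C x = g n *\<^sub>C T (a *\<^sub>C x)" using x(2) by simp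
    ultimately show ?thesis by blast
  qed
  have gr: "cmod (g n) \<le> r" for n
  proof -
    have "g n \<in> cball 0 r" using g(2) by blast
    thus ?thesis by simp
  qed
  from \<open>\<And>n. \<exists>e. norm e = 1 \<and> e = g n *\<^sub>C T e\<close>
  obtain e where e: "\<And>n. norm (e n) = 1" and eg: "\<And>n. e n = g n *\<^sub>C T (e n)" by metis
  obtain t s where s: "strict_mono (s::nat\<Rightarrow>nat)" "(\<lambda>n. T (e (s n))) \<longlonglongrightarrow> t"
    using convergent_image_subsequence[of e] e by (metis order_refl)
  have r0: "r > 0"
  proof -
    have "g 0 \<noteq> 0" using eg[of 0] e[of 0] by (metis norm_zero scaleC.zero_left zero_neq_one)
    with gr[of 0] show ?thesis by (meson less_le_trans zero_less_norm_iff)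
  qed
  have sep: "1 / r \<le> norm (T (e m) - T (e n))" if "m \<noteq> n" for m n
  proof -
    have gm: "g m \<noteq> 0" "g n \<noteq> 0" "cmod (g m) \<le> r"
      using eg[of m] eg[of n] e[of m] e[of n] g(2)
      by (metis norm_zero scaleC.zero_left zero_neq_one)+ (rule gr)
    have "cinner (e n) (e m) = 0"
      using char_vectors_orthogonal[OF eg[of n] eg[of m]] that g(1) by (metis injD)
    hence "g n * cinner (T (e n)) (e m) = 0" using eg[of n] by (metis cinner_scaleC_left)
    hence "g m * cinner (T (e m) - T (e n)) (e m) = g m * cinner (T (e m)) (e m)"
      using gm by (simp add: cinner.diff_left)
    also have "\<dots> = 1" using eg[of m] e[of m] cinner_self[of "e m"]
      by (metis cinner_scaleC_left of_real_1 power_one)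
    finally have "cmod (g m) * cmod (cinner (T (e m) - T (e n)) (e m)) = 1"
      by (metis norm_mult norm_one)
    moreover have "cmod (cinner (T (e m) - T (e n)) (e m)) \<le> norm (T (e m) - T (e n))"
      using cmod_cinner_le[of _ "e m"] e[of m] by (metis mult.right_neutral)
    ultimately have "1 \<le> r * norm (T (e m) - T (e n))"
      using gm(3) r0 by (metis mult_mono less_imp_le norm_ge_zero)
    thus ?thesis using r0 by (simp add: field_simps)
  qed
  have "Cauchy (\<lambda>n. T (e (s n)))" using s(2) by (rule LIMSEQ_imp_Cauchy)
  then obtain M where M: "\<And>m n. m \<ge> M \<Longrightarrow> n \<ge> M \<Longrightarrow> norm (T (e (s m)) - T (e (s n))) < 1 / r"
    using r0 by (meson Cauchy_iff zero_less_divide_1_iff)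
  have "s M \<noteq> s (Suc M)" using s(1) by (metis n_not_Suc_n strict_mono_eq)
  thus False using sep[of "s M" "s (Suc M)"] M[of M "Suc M"] by simp
qed

text \<open>In \<open>G\<^sub>y f(y) = G\<^sub>z f(y) + (y - z) G\<^sub>z G\<^sub>y f(y)\<close> the operators \<open>G\<^sub>y\<close> are bounded uniformly in \<open>y\<close>
  near \<open>z\<close>, so that the second summand tends to zero.\<close>
lemma continuous_inv_resolvent:
  assumes z: "z \<notin> char_values T" and f: "isCont f z"
  shows "isCont (\<lambda>y. inv_resolvent T y (f y)) z"
proof -
  obtain d where d: "d > 0" "cball z d \<subseteq> - char_values T"
    using open_regular z by (meson ComplI open_contains_cball)
  obtain C where C: "C > 0" "\<And>y x. y \<in> cball z d \<Longrightarrow> norm (inv_resolvent T y x) \<le> C * norm x"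
    using inv_resolvent_uniform_bound[OF compact_cball] d(2) by (metis disjoint_eq_subset_Compl inf_commute)
  have near: "eventually (\<lambda>y. y \<in> cball z d) (at z)"
    using d(1) by (simp add: eventually_at) (metis dist_commute less_imp_le)
  have ft: "(f \<longlongrightarrow> f z) (at z)" using f by (simp add: isCont_def)
  have lim: "((\<lambda>y. (y - z) *\<^sub>C inv_resolvent T z (inv_resolvent T y (f y))) \<longlongrightarrow> 0) (at z)"
  proof (rule Lim_null_comparison)
    show "eventually (\<lambda>y. norm ((y - z) *\<^sub>C inv_resolvent T z (inv_resolvent T y (f y)))
        \<le> norm (y - z) * (C * (C * norm (f y)))) (at z)"
      using near
    proof eventually_elim
      case (elim y)
      have "norm (inv_resolvent T z (inv_resolvent T y (f y))) \<le> C * norm (inv_resolvent T y (f y))"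
        using C(2)[of z] d(1) by simp
      also have "\<dots> \<le> C * (C * norm (f y))" using C elim by (intro mult_left_mono) auto
      finally show ?case by (simp add: norm_scaleC mult_left_mono)
    qed
    have "((\<lambda>y. norm (y - z) * (C * (C * norm (f y)))) \<longlongrightarrow> norm (z - z) * (C * (C * norm (f z)))) (at z)"
      by (intro tendsto_intros ft)
    thus "((\<lambda>y. norm (y - z) * (C * (C * norm (f y)))) \<longlongrightarrow> 0) (at z)" by simp
  qed
  have "((\<lambda>y. inv_resolvent T z (f y) + (y - z) *\<^sub>C inv_resolvent T z (inv_resolvent T y (f y))) \<longlongrightarrow> inv_resolvent T z (f z) + 0) (at z)"
    by (intro tendsto_add lim bounded_linear.tendsto[OF inv_resolvent_bounded_linear[OF z] ft])
  moreover have "eventually (\<lambda>y. inv_resolvent T z (f y) + (y - z) *\<^sub>C inv_resolvent T z (inv_resolvent T y (f y))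
       = inv_resolvent T y (f y)) (at z)"
    using near by eventually_elim (metis resolvent_identity ComplD d(2) subsetD z)
  ultimately show ?thesis unfolding isCont_def by (simp add: tendsto_cong)
qed

end

lemma has_derivative_centred_scaleC:
  fixes \<Phi> :: "complex \<Rightarrow> 'a::complex_inner"
  assumes "isCont \<Phi> z"
  shows "((\<lambda>y. (y - z) *\<^sub>C \<Phi> y) has_derivative (\<lambda>h. h *\<^sub>C \<Phi> z)) (at z)"
proof (rule has_derivativeI)
  show "bounded_linear (\<lambda>h. h *\<^sub>C \<Phi> z)" by (rule scaleC.bounded_linear_left)
  have "(\<lambda>y. norm (\<Phi> y - \<Phi> z)) \<midarrow>z\<rightarrow> norm (\<Phi> z - \<Phi> z)"
    using assms unfolding isCont_def by (intro tendsto_intros)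
  hence "(\<lambda>y. norm (\<Phi> y - \<Phi> z)) \<midarrow>z\<rightarrow> 0" by simp
  moreover have "eventually (\<lambda>y. norm (((y - z) *\<^sub>C \<Phi> y - (z - z) *\<^sub>C \<Phi> z) - (y - z) *\<^sub>C \<Phi> z) / norm (y - z)
      = norm (\<Phi> y - \<Phi> z)) (at z)"
    by (auto simp: eventually_at_filter scaleC.diff_right[symmetric] norm_scaleC)
  ultimately show "(\<lambda>y. (((y - z) *\<^sub>C \<Phi> y - (z - z) *\<^sub>C \<Phi> z) - (y - z) *\<^sub>C \<Phi> z) /\<^sub>R norm (y - z)) \<midarrow>z\<rightarrow> 0"
    by (subst tendsto_norm_zero_iff[symmetric]) (simp add: tendsto_cong divide_inverse mult.commute)
qed

context compact_normal_operator
begin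

text \<open>A product rule. The resolvent identity writes \<open>G\<^sub>y f(y)\<close> as \<open>G\<^sub>z f(y)\<close>, which is differentiated
  through the fixed operator \<open>G\<^sub>z\<close>, plus \<open>y - z\<close> times a function that is merely required to be
  continuous at \<open>z\<close>.\<close>
lemma inv_resolvent_has_derivative:
  assumes z: "z \<notin> char_values T" and f: "(f has_derivative (\<lambda>h. h *\<^sub>C f')) (at z)"
  shows "((\<lambda>y. inv_resolvent T y (f y)) has_derivative
          (\<lambda>h. h *\<^sub>C (inv_resolvent T z (inv_resolvent T z (f z)) + inv_resolvent T z f'))) (at z)"
proof -
  define \<Phi> where "\<Phi> = (\<lambda>y. inv_resolvent T z (inv_resolvent T y (f y)))"
  have "isCont f z" using f has_derivative_continuous by blast
  hence "isCont (\<lambda>y. inv_resolvent T y (f y)) z" by (rule continuous_inv_resolvent[OF z])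
  hence \<Phi>: "isCont \<Phi> z" unfolding \<Phi>_def isCont_def
    by (rule bounded_linear.tendsto[OF inv_resolvent_bounded_linear[OF z]])
  have "((\<lambda>y. inv_resolvent T z (f y)) has_derivative (\<lambda>h. inv_resolvent T z (h *\<^sub>C f'))) (at z)"
    by (rule bounded_linear.has_derivative[OF inv_resolvent_bounded_linear[OF z] f])
  from has_derivative_add[OF this has_derivative_centred_scaleC[OF \<Phi>]]
  have "((\<lambda>y. inv_resolvent T z (f y) + (y - z) *\<^sub>C \<Phi> y) has_derivative
          (\<lambda>h. h *\<^sub>C (inv_resolvent T z (inv_resolvent T z (f z)) + inv_resolvent T z f'))) (at z)"
    by (simp add: \<Phi>_def inv_resolvent_scaleC[OF z] scaleC.add_right add.commute)
  thus ?thesis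
    by (rule has_derivative_transform_within_open[OF _ open_regular])
       (use z in \<open>auto simp: \<Phi>_def resolvent_identity[OF _ z, symmetric]\<close>)
qed

lemma inv_resolvent_power_has_derivative:
  assumes z: "z \<notin> char_values T"
  shows "((\<lambda>y. (inv_resolvent T y ^^ n) v) has_derivative
          (\<lambda>h. h *\<^sub>C (of_nat n *\<^sub>C (inv_resolvent T z ^^ Suc n) v))) (at z)"
proof (induction n)
  case 0
  show ?case by simp
next
  case (Suc n)
  show ?case
    using inv_resolvent_has_derivative[OF z Suc]
    by (simp add: inv_resolvent_scaleC[OF z] scaleC_add_left scaleC_one)
qed

end

section \<open>Taylor coefficients\<close>

lemma has_field_derivative_iff_has_derivative:
  "(f has_field_derivative c) F \<longleftrightarrow> (f has_derivative (\<lambda>h. h * c)) F"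
  unfolding has_field_derivative_def by (subst mult_commute_abs) (rule refl)

lemma vderiv_eqI:
  assumes "(F has_derivative (\<lambda>h. h *\<^sub>C F')) (at z)"
  shows "vderiv F z = F'"
  unfolding vderiv_def
proof (rule some_equality)
  fix G assume "(F has_derivative (\<lambda>h. h *\<^sub>C G)) (at z)"
  hence "(\<lambda>h. h *\<^sub>C G) = (\<lambda>h. h *\<^sub>C F')" using assms by (rule has_derivative_unique)
  thus "G = F'" by (metis scaleC_one)
qed (rule assms)

text \<open>A family with \<open>u\<^sub>n' = (n + 1) u\<^sub>n\<^sub>+\<^sub>1\<close> is the family of Taylor coefficients of its first member, as
  functions of the centre. Working with such families keeps factorials out of the product rule.\<close>
lemma taylor_coeff_tower:
  assumes U: "open U" "z \<in> U"
    and u: "\<And>n z. z \<in> U \<Longrightarrow> (u n has_derivative (\<lambda>h. h *\<^sub>C (of_nat (Suc n) *\<^sub>C u (Suc n) z))) (at z)"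
    and F: "\<And>z. z \<in> U \<Longrightarrow> F z = u 0 z"
  shows "taylor_coeff F n z = u n z"
proof -
  have "(vderiv ^^ n) F y = fact n *\<^sub>C u n y" if "y \<in> U" for y
    using that
  proof (induction n arbitrary: y)
    case 0
    thus ?case by (simp add: F scaleC_one)
  next
    case (Suc n)
    have "((\<lambda>y. fact n *\<^sub>C u n y) has_derivative (\<lambda>h. fact n *\<^sub>C (h *\<^sub>C (of_nat (Suc n) *\<^sub>C u (Suc n) y)))) (at y)"
      by (rule bounded_linear.has_derivative[OF scaleC.bounded_linear_right u[OF Suc.prems]])
    moreover have "fact n *\<^sub>C (h *\<^sub>C (of_nat (Suc n) *\<^sub>C u (Suc n) y)) = h *\<^sub>C (fact (Suc n) *\<^sub>C u (Suc n) y)" for h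
      by (simp only: scaleC_scaleC fact_Suc mult_ac)
    ultimately have "((\<lambda>y. fact n *\<^sub>C u n y) has_derivative (\<lambda>h. h *\<^sub>C (fact (Suc n) *\<^sub>C u (Suc n) y))) (at y)"
      by (simp only:)
    hence "((vderiv ^^ n) F has_derivative (\<lambda>h. h *\<^sub>C (fact (Suc n) *\<^sub>C u (Suc n) y))) (at y)"
      by (rule has_derivative_transform_within_open[OF _ U(1) Suc.prems]) (simp only: Suc.IH)
    thus ?case by (simp only: funpow.simps o_apply vderiv_eqI)
  qed
  from this[OF U(2)] show ?thesis
    by (simp add: taylor_coeff_def scaleC_scaleC scaleC_one)
qed

text \<open>The derivative of a Cauchy product of two such families, one scalar and one vector-valued: the
  weights \<open>n - i + 1\<close> and \<open>i\<close> of a term add up to \<open>n + 1\<close>.\<close>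
lemma sum_convolution_tower:
  fixes u :: "nat \<Rightarrow> 'a::complex_inner"
  shows "(\<Sum>i\<le>n. p i *\<^sub>C (of_nat (Suc (n - i)) *\<^sub>C u (Suc (n - i))) + (of_nat (Suc i) * p (Suc i)) *\<^sub>C u (n - i))
    = of_nat (Suc n) *\<^sub>C (\<Sum>i\<le>Suc n. p i *\<^sub>C u (Suc n - i))"
proof -
  define c where "c i = p i *\<^sub>C u (Suc n - i)" for i
  have "(\<Sum>i\<le>n. p i *\<^sub>C (of_nat (Suc (n - i)) *\<^sub>C u (Suc (n - i)))) = (\<Sum>i\<le>n. of_nat (Suc n - i) *\<^sub>C c i)"
    by (intro sum.cong refl) (simp add: c_def scaleC_scaleC Suc_diff_le mult.commute)
  also have "\<dots> = (\<Sum>i\<le>Suc n. of_nat (Suc n - i) *\<^sub>C c i)" by simp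
  finally have 1: "(\<Sum>i\<le>n. p i *\<^sub>C (of_nat (Suc (n - i)) *\<^sub>C u (Suc (n - i)))) = \<dots>" .
  have 2: "(\<Sum>i\<le>n. (of_nat (Suc i) * p (Suc i)) *\<^sub>C u (n - i)) = (\<Sum>i\<le>Suc n. of_nat i *\<^sub>C c i)"
    by (subst sum.atMost_Suc_shift) (simp add: c_def scaleC_scaleC)
  have "(\<Sum>i\<le>Suc n. of_nat (Suc n - i) *\<^sub>C c i) + (\<Sum>i\<le>Suc n. of_nat i *\<^sub>C c i)
      = (\<Sum>i\<le>Suc n. of_nat (Suc n) *\<^sub>C c i)"
    unfolding sum.distrib[symmetric]
    by (intro sum.cong refl) (simp add: scaleC_add_left[symmetric] of_nat_diff)
  thus ?thesis
    unfolding sum.distrib 1 2 by (simp only: scaleC.sum_right c_def)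
qed

lemma taylor_coeff_poly_scaleC_tower:
  fixes u :: "nat \<Rightarrow> complex \<Rightarrow> 'a::complex_inner"
  assumes U: "open U" "z0 \<in> U"
    and u: "\<And>n z. z \<in> U \<Longrightarrow> (u n has_derivative (\<lambda>h. h *\<^sub>C (of_nat (Suc n) *\<^sub>C u (Suc n) z))) (at z)"
    and F: "\<And>z. z \<in> U \<Longrightarrow> F z = u 0 z"
  shows "taylor_coeff (\<lambda>z. poly p (z - z0) *\<^sub>C F z) n z0 = (\<Sum>i\<le>n. coeff p i *\<^sub>C u (n - i) z0)"
proof -
  \<comment> \<open>The Taylor coefficients of the polynomial as functions of the centre \<open>z\<close>.\<close>
  define P where "P i z = poly ((pderiv ^^ i) p) (z - z0) / fact i" for i z
  have P: "(P i has_derivative (\<lambda>h. h * (of_nat (Suc i) * P (Suc i) z))) (at z)" for i z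
  proof -
    have nz: "1 + complex_of_nat i \<noteq> 0" by (metis of_nat_Suc of_nat_neq_0)
    have "(P i has_field_derivative poly (pderiv ((pderiv ^^ i) p)) (z - z0) * 1 / fact i) (at z)"
      unfolding P_def
      by (intro DERIV_cdivide DERIV_chain2[OF poly_DERIV]) (auto intro!: derivative_eq_intros)
    hence "(P i has_field_derivative (of_nat (Suc i) * P (Suc i) z)) (at z)"
      using nz by (simp add: P_def)
    thus ?thesis unfolding has_field_derivative_iff_has_derivative .
  qed
  define c where "c n z = (\<Sum>i\<le>n. P i z *\<^sub>C u (n - i) z)" for n z
  have c: "(c n has_derivative (\<lambda>h. h *\<^sub>C (of_nat (Suc n) *\<^sub>C c (Suc n) z))) (at z)" if z: "z \<in> U" for n z
  proof -
    have "(c n has_derivative (\<lambda>h. \<Sum>i\<le>n. P i z *\<^sub>C (h *\<^sub>C (of_nat (Suc (n - i)) *\<^sub>C u (Suc (n - i)) z))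
        + (h * (of_nat (Suc i) * P (Suc i) z)) *\<^sub>C u (n - i) z)) (at z)"
      unfolding c_def by (intro has_derivative_sum scaleC.FDERIV P u z)
    moreover have "P i z *\<^sub>C (h *\<^sub>C (of_nat (Suc (n - i)) *\<^sub>C u (Suc (n - i)) z))
        + (h * (of_nat (Suc i) * P (Suc i) z)) *\<^sub>C u (n - i) z
      = h *\<^sub>C (P i z *\<^sub>C (of_nat (Suc (n - i)) *\<^sub>C u (Suc (n - i)) z)
        + (of_nat (Suc i) * P (Suc i) z) *\<^sub>C u (n - i) z)" for i h
      by (simp add: scaleC_scaleC scaleC.add_right mult_ac)
    ultimately show ?thesis
      unfolding c_def[of "Suc n"]
      by (simp only: scaleC.sum_right[symmetric]
          sum_convolution_tower[of "\<lambda>i. P i z" n "\<lambda>i. u i z"])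
  qed
  have "taylor_coeff (\<lambda>z. poly p (z - z0) *\<^sub>C F z) n z0 = c n z0"
    by (rule taylor_coeff_tower[OF U c]) (simp_all add: c_def F P_def)
  moreover have "P i z0 = coeff p i" for i
    by (simp add: P_def poly_0_coeff_0 coeff_higher_pderiv pochhammer_fact[symmetric])
  ultimately show ?thesis by (simp add: c_def)
qed

lemma (in compact_normal_operator) taylor_coeff_resolvent:
  assumes z0: "z0 \<notin> char_values T" and S: "\<And>z. z \<notin> char_values T \<Longrightarrow> S z = inv_resolvent T z v"
  shows "taylor_coeff (\<lambda>z. poly p (z - z0) *\<^sub>C S z) n z0
    = (\<Sum>i\<le>n. coeff p i *\<^sub>C (inv_resolvent T z0 ^^ Suc (n - i)) v)"
proof -
  define u where "u n z = (inv_resolvent T z ^^ Suc n) v" for n z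
  have u: "(u n has_derivative (\<lambda>h. h *\<^sub>C (of_nat (Suc n) *\<^sub>C u (Suc n) z))) (at z)"
    if "z \<in> - char_values T" for n z
    unfolding u_def using that by (intro inv_resolvent_power_has_derivative) simp
  have F: "S z = u 0 z" if "z \<in> - char_values T" for z
    using that S by (simp add: u_def)
  have "z0 \<in> - char_values T" using z0 by simp
  from taylor_coeff_poly_scaleC_tower[OF open_regular this u F, of p n]
  show ?thesis by (simp only: u_def)
qed

section \<open>Operators with compact normal inverse\<close>

lemma
  fixes D :: "'a::complex_inner set"
  assumes lin: "clinear_on D L" and bij: "bij_betw L D UNIV"
  shows eigenspace_eq: "eigenspace D L l = {x. x = l *\<^sub>C inv_into D L x}"
    and op_spectrum_eq: "op_spectrum D L = char_values (inv_into D L)"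
proof -
  define T where "T = inv_into D L"
  have T: "T x \<in> D" "L (T x) = x" for x
    using bij unfolding T_def bij_betw_def by (metis inv_into_into UNIV_I, metis f_inv_into_f UNIV_I)
  have TL: "T (L x) = x" if "x \<in> D" for x
    using bij that unfolding T_def bij_betw_def by simp
  have D: "a *\<^sub>C x \<in> D" "L (a *\<^sub>C x) = a *\<^sub>C L x" if "x \<in> D" for a x
    using lin that by (auto simp: clinear_on_def csubspace_scaleC)
  have Ts: "T (a *\<^sub>C x) = a *\<^sub>C T x" for a x
    by (metis D T TL)
  have iff: "x \<in> D \<and> L x = l *\<^sub>C x \<longleftrightarrow> x = l *\<^sub>C T x" for x l
    by (metis D T TL Ts)
  show "eigenspace D L l = {x. x = l *\<^sub>C inv_into D L x}"
    unfolding eigenspace_def T_def[symmetric] using iff by blast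
  show "op_spectrum D L = char_values (inv_into D L)"
    unfolding op_spectrum_def char_values_def T_def[symmetric] using iff by blast
qed

text \<open>The substitution \<open>u = T y\<close> turns \<open>(L - z) u = v\<close> into \<open>y - z T y = v\<close>.\<close>
lemma resolvent_map_eq:
  fixes D :: "'a::complex_hilbert_space set"
  assumes lin: "clinear_on D L" and bij: "bij_betw L D UNIV"
    and T: "compact_normal_operator (inv_into D L)" and z: "z \<notin> char_values (inv_into D L)"
  shows "resolvent_map D L v z = inv_resolvent (inv_into D L) z v"
proof -
  interpret compact_normal_operator "inv_into D L" by (rule T)
  let ?T = "inv_into D L"
  have TD: "?T x \<in> D" "L (?T x) = x" for x
    using bij unfolding bij_betw_def by (metis inv_into_into UNIV_I, metis f_inv_into_f UNIV_I)
  have TL: "?T (L x) = x" if "x \<in> D" for x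
    using bij that unfolding bij_betw_def by simp
  obtain y where y: "y - z *\<^sub>C ?T y = v" "inv_resolvent ?T z v = ?T y" using inv_resolvent_cases[OF z] by metis
  show ?thesis unfolding resolvent_map_def
  proof (rule the_equality)
    show "inv_resolvent ?T z v \<in> D \<and> L (inv_resolvent ?T z v) - z *\<^sub>C inv_resolvent ?T z v = v" using y TD by simp
    fix u assume u: "u \<in> D \<and> L u - z *\<^sub>C u = v"
    hence "L u - z *\<^sub>C ?T (L u) = v" by (simp add: TL)
    from inv_resolvent_eqI[OF z this] show "u = inv_resolvent ?T z v" using u TL by simp
  qed
qed

section \<open>The remainder of the approximation\<close>

context compact_normal_operator
begin

text \<open>The Neumann series of \<open>G\<^sub>z\<close> at \<open>z0\<close>, truncated with exact remainder; it holds for all regular \<open>z\<close>,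
  not only within the radius of convergence.\<close>
lemma resolvent_expansion:
  assumes z: "z \<notin> char_values T" and z0: "z0 \<notin> char_values T"
  shows "inv_resolvent T z x = (\<Sum>n<k. (z - z0) ^ n *\<^sub>C (inv_resolvent T z0 ^^ Suc n) x)
    + (z - z0) ^ k *\<^sub>C inv_resolvent T z ((inv_resolvent T z0 ^^ k) x)"
proof (induction k)
  case 0
  show ?case by (simp add: scaleC_one)
next
  case (Suc k)
  have "inv_resolvent T z y = inv_resolvent T z0 y + (z - z0) *\<^sub>C inv_resolvent T z (inv_resolvent T z0 y)" for y
    using resolvent_identity[OF z0 z, of y] by (simp add: scaleC.diff_left algebra_simps)
  from this[of "(inv_resolvent T z0 ^^ k) x"] show ?case
    by (subst Suc.IH) (simp add: scaleC.add_right scaleC_scaleC mult.commute)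
qed

lemma inv_resolvent_sum:
  assumes z: "z \<notin> char_values T"
  shows "inv_resolvent T z (\<Sum>i\<in>I. a i *\<^sub>C x i) = (\<Sum>i\<in>I. a i *\<^sub>C inv_resolvent T z (x i))"
  by (simp add: linear_sum[OF bounded_linear.linear[OF inv_resolvent_bounded_linear[OF z]]] inv_resolvent_scaleC[OF z])

text \<open>Each monomial \<open>w\<^sup>j\<close> of \<open>Q\<close> is multiplied by the expansion of \<open>G\<^sub>z v\<close> of order \<open>M + 1 - j\<close>: the
  finite sums combine to the numerator, and all remainders carry the same power of \<open>w\<close>.\<close>
lemma remainder_formula:
  fixes S :: "complex \<Rightarrow> 'a"
  assumes z: "z \<notin> char_values T" and z0: "z0 \<notin> char_values T"
    and S: "\<And>z. z \<notin> char_values T \<Longrightarrow> S z = inv_resolvent T z v" and deg: "degree p \<le> Suc M"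
  defines "Q \<equiv> \<lambda>z. poly p (z - z0)"
  shows "Q z *\<^sub>C S z - fast_LS_Pade_numerator S z0 M Q z
    = (z - z0) ^ Suc M *\<^sub>C inv_resolvent T z (\<Sum>j\<le>Suc M. coeff p j *\<^sub>C (inv_resolvent T z0 ^^ (Suc M - j)) v)"
proof -
  define w where "w = z - z0"
  define A where "A = inv_resolvent T z0"
  let ?q = "coeff p"
  have Qz: "Q z = (\<Sum>j\<le>Suc M. ?q j * w ^ j)"
    unfolding Q_def w_def poly_altdef using deg
    by (intro sum.mono_neutral_left) (auto simp: coeff_eq_0)
  have tc: "taylor_coeff (\<lambda>w. Q w *\<^sub>C S w) n z0 = (\<Sum>i\<le>n. ?q i *\<^sub>C (A ^^ Suc (n - i)) v)" for n
    unfolding Q_def A_def by (rule taylor_coeff_resolvent[OF z0 S])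
  have "Q z *\<^sub>C S z = (\<Sum>j\<le>Suc M. (?q j * w ^ j) *\<^sub>C
      ((\<Sum>n<Suc M - j. w ^ n *\<^sub>C (A ^^ Suc n) v) + w ^ (Suc M - j) *\<^sub>C inv_resolvent T z ((A ^^ (Suc M - j)) v)))"
    unfolding Qz S[OF z] scaleC.sum_left
    by (intro sum.cong refl arg_cong2[where f = scaleC])
       (simp only: w_def A_def resolvent_expansion[OF z z0, symmetric])
  also have "\<dots> = (\<Sum>j\<le>Suc M. \<Sum>n<Suc M - j. (?q j * w ^ (j + n)) *\<^sub>C (A ^^ Suc n) v)
      + (\<Sum>j\<le>Suc M. (?q j * w ^ Suc M) *\<^sub>C inv_resolvent T z ((A ^^ (Suc M - j)) v))"
    by (simp only: scaleC.add_right sum.distrib scaleC.sum_right scaleC_scaleC power_add mult.assoc)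
       (auto intro!: sum.cong simp: power_add[symmetric] simp del: power_Suc)
  also have "(\<Sum>j\<le>Suc M. (?q j * w ^ Suc M) *\<^sub>C inv_resolvent T z ((A ^^ (Suc M - j)) v))
      = w ^ Suc M *\<^sub>C inv_resolvent T z (\<Sum>j\<le>Suc M. ?q j *\<^sub>C (A ^^ (Suc M - j)) v)"
    by (simp only: inv_resolvent_sum[OF z] scaleC.sum_right scaleC_scaleC mult.commute)
  also have "(\<Sum>j\<le>Suc M. \<Sum>n<Suc M - j. (?q j * w ^ (j + n)) *\<^sub>C (A ^^ Suc n) v)
      = (\<Sum>(j,n)\<in>{(j,n). j + n < Suc M}. (?q j * w ^ (j + n)) *\<^sub>C (A ^^ Suc n) v)"
    by (subst sum.Sigma) (auto intro!: sum.cong)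
  also have "\<dots> = (\<Sum>n<Suc M. \<Sum>i\<le>n. (?q i * w ^ (i + (n - i))) *\<^sub>C (A ^^ Suc (n - i)) v)"
    by (rule sum.triangle_reindex)
  also have "\<dots> = fast_LS_Pade_numerator S z0 M Q z"
    unfolding fast_LS_Pade_numerator_def tc w_def[symmetric]
    by (simp only: scaleC.sum_right scaleC_scaleC lessThan_Suc_atMost)
       (auto intro!: sum.cong simp: mult.commute)
  finally show ?thesis by (simp add: w_def A_def)
qed

text \<open>If \<open>N \<le> M\<close>, the vector of the remainder formula is the residual \<open>d\<close> itself. If \<open>N = M + 1\<close>, the
  residual is one power of the resolvent further, \<open>d = A g\<close>, and \<open>G\<^sub>z g = A g + w G\<^sub>z A g\<close> recovers a
  bound in terms of \<open>d\<close>.\<close>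
lemma remainder_bound:
  fixes S :: "complex \<Rightarrow> 'a"
  assumes z: "z \<notin> char_values T" and z0: "z0 \<notin> char_values T"
    and S: "\<And>z. z \<notin> char_values T \<Longrightarrow> S z = inv_resolvent T z v"
    and deg: "degree p \<le> N" and NM: "N \<le> Suc M"
    and C: "\<And>x. norm (inv_resolvent T z x) \<le> C * norm x" "C \<ge> 0"
  defines "Q \<equiv> \<lambda>z. poly p (z - z0)"
  shows "norm (Q z *\<^sub>C S z - fast_LS_Pade_numerator S z0 M Q z)
    \<le> cmod (z - z0) ^ Suc M * ((1 + (1 + cmod (z - z0)) * C) * ls_functional S z0 (max M N) Q)"
proof -
  define g where "g = (\<Sum>j\<le>Suc M. coeff p j *\<^sub>C (inv_resolvent T z0 ^^ (Suc M - j)) v)"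
  define d where "d = taylor_coeff (\<lambda>z. Q z *\<^sub>C S z) (max M N) z0"
  have d: "d = (\<Sum>i\<le>max M N. coeff p i *\<^sub>C (inv_resolvent T z0 ^^ Suc (max M N - i)) v)"
    unfolding d_def Q_def by (rule taylor_coeff_resolvent[OF z0 S])
  have ls: "ls_functional S z0 (max M N) Q = norm d" by (simp add: ls_functional_def d_def)
  have "norm (inv_resolvent T z g) \<le> (1 + (1 + cmod (z - z0)) * C) * norm d"
  proof (cases "N \<le> M")
    case True
    hence "coeff p (Suc M) = 0" using deg by (simp add: coeff_eq_0)
    hence "g = d" using True unfolding d g_def
      by (auto simp: max_def Suc_diff_le intro!: sum.cong)
    hence "norm (inv_resolvent T z g) \<le> C * norm d" using C by simp
    also have "\<dots> \<le> (1 + (1 + cmod (z - z0)) * C) * norm d"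
      using C(2) by (intro mult_right_mono) (auto simp: algebra_simps intro: add_nonneg_nonneg)
    finally show ?thesis .
  next
    case False
    hence N: "max M N = Suc M" using NM by simp
    have "d = inv_resolvent T z0 g" unfolding d g_def N by (simp only: inv_resolvent_sum[OF z0] funpow.simps o_apply)
    hence "inv_resolvent T z g = d + (z - z0) *\<^sub>C inv_resolvent T z d"
      using resolvent_expansion[OF z z0, of g 1] by (simp add: scaleC_one)
    hence "norm (inv_resolvent T z g) \<le> norm d + cmod (z - z0) * (C * norm d)"
      using norm_triangle_ineq[of d "(z - z0) *\<^sub>C inv_resolvent T z d"] mult_left_mono[OF C(1)[of d], of "cmod (z - z0)"]
      by (simp add: norm_scaleC)
    also have "\<dots> \<le> (1 + (1 + cmod (z - z0)) * C) * norm d"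
      using C(2) by (simp add: algebra_simps)
    finally show ?thesis .
  qed
  moreover have "degree p \<le> Suc M" using deg NM by simp
  from remainder_formula[OF z z0 S this]
  have "Q z *\<^sub>C S z - fast_LS_Pade_numerator S z0 M Q z = (z - z0) ^ Suc M *\<^sub>C inv_resolvent T z g"
    unfolding Q_def g_def .
  ultimately show ?thesis
    unfolding ls by (simp only: norm_scaleC norm_power) (intro mult_left_mono zero_le_power norm_ge_zero)
qed

end

section \<open>Growth of the resolvent coefficients\<close>

context compact_normal_operator
begin

text \<open>Cauchy's inequality for the scalar functions \<open>z \<mapsto> \<langle>G\<^sub>z v, x\<rangle>\<close>, uniformly in the unit vectors \<open>x\<close>.\<close>
lemma resolvent_coeff_growth:
  assumes r: "r > 0" and reg: "cball z0 r \<inter> char_values T = {}"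
  obtains C where "C \<ge> 0" "\<And>n. norm ((inv_resolvent T z0 ^^ Suc n) v) \<le> C / r ^ n"
proof -
  obtain C0 where C0: "C0 > 0" "\<And>z x. z \<in> cball z0 r \<Longrightarrow> norm (inv_resolvent T z x) \<le> C0 * norm x"
    using inv_resolvent_uniform_bound[OF compact_cball reg] by metis
  have "norm ((inv_resolvent T z0 ^^ Suc n) v) \<le> C0 * norm v / r ^ n" for n
  proof (rule norm_le_of_cinner_le)
    fix x
    \<comment> \<open>Up to the factor \<open>fact n\<close>, the derivative of order \<open>n\<close> of \<open>f 0\<close>.\<close>
    define f where "f n z = cinner ((inv_resolvent T z ^^ Suc n) v) x" for n z
    have f: "(f n has_field_derivative of_nat (Suc n) * f (Suc n) z) (at z)"
      if "z \<notin> char_values T" for n z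
      using bounded_linear.has_derivative[OF cinner.bounded_linear_left
          inv_resolvent_power_has_derivative[OF that, of "Suc n" v], of x]
      unfolding f_def has_field_derivative_iff_has_derivative
      by (simp only: cinner_scaleC_left)
    have d: "(deriv ^^ n) (f 0) z = fact n * f n z" if "z \<notin> char_values T" for n z
      using that
    proof (induction n arbitrary: z)
      case (Suc n)
      have "((\<lambda>z. fact n * f n z) has_field_derivative fact n * (of_nat (Suc n) * f (Suc n) z)) (at z)"
        by (rule DERIV_cmult[OF f[OF Suc.prems]])
      hence "((deriv ^^ n) (f 0) has_field_derivative fact n * (of_nat (Suc n) * f (Suc n) z)) (at z)"
        by (rule has_field_derivative_transform_within_open[OF _ open_regular]) (use Suc in auto)
      thus ?case by (simp add: DERIV_imp_deriv)
    qed simp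
    have z0: "z0 \<notin> char_values T" using reg r by (meson centre_in_cball disjoint_iff less_imp_le)
    have hol: "f 0 holomorphic_on - char_values T"
      using f[of _ 0] open_regular by (auto simp: holomorphic_on_open)
    have "cmod ((deriv ^^ n) (f 0) z0) \<le> fact n * (C0 * norm v * norm x) / r ^ n"
    proof (rule Cauchy_inequality)
      have sub: "cball z0 r \<subseteq> - char_values T" using reg by blast
      show "f 0 holomorphic_on ball z0 r"
        using sub ball_subset_cball by (intro holomorphic_on_subset[OF hol]) blast
      show "continuous_on (cball z0 r) (f 0)"
        using sub by (intro holomorphic_on_imp_continuous_on holomorphic_on_subset[OF hol])
      fix z assume "cmod (z0 - z) = r"
      hence "norm (inv_resolvent T z v) \<le> C0 * norm v" by (intro C0(2)) (simp add: dist_norm)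
      thus "cmod (f 0 z) \<le> C0 * norm v * norm x"
        unfolding f_def using cmod_cinner_le[of "inv_resolvent T z v" x]
        by (simp add: mult_right_mono order_trans)
    qed (rule r)
    hence "fact n * cmod (f n z0) \<le> fact n * (C0 * norm v / r ^ n * norm x)"
      unfolding d[OF z0] by (simp add: norm_mult)
    thus "cmod (cinner ((inv_resolvent T z0 ^^ Suc n) v) x) \<le> C0 * norm v / r ^ n * norm x"
      unfolding f_def by (rule mult_left_le_imp_le) simp
  qed (use C0 r in simp)
  thus ?thesis using that[of "C0 * norm v"] C0 by simp
qed

text \<open>Invariance under \<open>T\<close> and its adjoint makes the projection commute with both, so the compression of
  \<open>T\<close> to \<open>W\<close>, extended by zero, is again compact and normal. Extending by zero keeps the operator on
  the whole space, so that everything proved for \<open>T\<close> applies to it.\<close>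
lemma
  assumes W: "csubspace W" "closed W"
    and T_W: "\<And>x. x \<in> W \<Longrightarrow> T x \<in> W" and adj_W: "\<And>x. x \<in> W \<Longrightarrow> adj x \<in> W"
  shows orth_proj_commute: "orth_proj W (T x) = T (orth_proj W x)"
    and compact_normal_compose_proj: "compact_normal_operator (\<lambda>x. T (orth_proj W x))"
proof -
  note pW = orth_proj_in[OF W]
  have c1: "orth_proj W (T x) = T (orth_proj W x)" for x
  proof (rule orth_proj_eqI[OF W T_W[OF pW]])
    fix w assume "w \<in> W"
    hence "cinner (x - orth_proj W x) (adj w) = 0" by (intro orth_proj_orthogonal[OF W] adj_W)
    thus "cinner (T x - T (orth_proj W x)) w = 0" by (simp add: diff[symmetric] cinner_adj)
  qed
  have c2: "orth_proj W (adj x) = adj (orth_proj W x)" for x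
  proof (rule orth_proj_eqI[OF W adj_W[OF pW]])
    fix w assume "w \<in> W"
    hence "cinner (x - orth_proj W x) (T w) = 0" by (intro orth_proj_orthogonal[OF W] T_W)
    thus "cinner (adj x - adj (orth_proj W x)) w = 0"
      by (simp add: cinner.diff_left cinner_adj'[symmetric])
  qed
  show "orth_proj W (T x) = T (orth_proj W x)" by (rule c1)
  have P: "bounded_linear (orth_proj W)"
    by (rule bounded_linear_intro[of _ 1])
       (simp_all add: orth_proj_add[OF W] orth_proj_scaleC[OF W] scaleR_scaleC norm_orth_proj_le[OF W])
  have lin: "clinear_on UNIV (\<lambda>x. T (orth_proj W x))"
    unfolding clinear_on_def
    by (auto intro!: csubspaceI simp: orth_proj_add[OF W] orth_proj_scaleC[OF W] add scaleC_arg)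
  show "compact_normal_operator (\<lambda>x. T (orth_proj W x))"
  proof
    have "compact (closure ((\<lambda>x. T (orth_proj W x)) ` B))" if "bounded B" for B
    proof -
      have "bounded (orth_proj W ` B)" by (rule bounded_linear_image[OF that P])
      hence "compact (closure (T ` orth_proj W ` B))"
        using compact by (simp add: compact_operator_def)
      thus ?thesis by (simp add: image_image)
    qed
    with lin show "compact_operator (\<lambda>x. T (orth_proj W x))" by (simp add: compact_operator_def)
    have "is_cadjoint (\<lambda>x. T (orth_proj W x)) (\<lambda>x. orth_proj W (adj x))"
      by (simp add: is_cadjoint_def cinner_adj orth_proj_selfadjoint[OF W])
    moreover have "(\<lambda>x. T (orth_proj W x)) \<circ> (\<lambda>x. orth_proj W (adj x))
        = (\<lambda>x. orth_proj W (adj x)) \<circ> (\<lambda>x. T (orth_proj W x))"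
      by (simp add: fun_eq_iff adj_commute[symmetric] c1 c2)
    ultimately show "normal_operator (\<lambda>x. T (orth_proj W x))"
      unfolding normal_operator_def using lin bounded_linear_compose[OF bounded_linear P]
      by (auto simp: o_def)
  qed
qed

text \<open>The orthogonal complement of the eigenspaces with characteristic values in \<open>F\<close>.\<close>
definition eigen_complement :: "complex set \<Rightarrow> 'a set" where
  "eigen_complement F = {x. \<forall>l\<in>F. \<forall>e. e = l *\<^sub>C T e \<longrightarrow> cinner x e = 0}"

lemma csubspace_eigen_complement: "csubspace (eigen_complement F)"
  by (rule csubspaceI) (auto simp: eigen_complement_def cinner.add_left cinner_scaleC_left)

lemma closed_eigen_complement: "closed (eigen_complement F)"
proof -
  have "closed {x. cinner x e = 0}" for e :: 'a
    by (intro closed_Collect_eq continuous_on_const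
        bounded_linear.continuous_on[OF cinner.bounded_linear_left] continuous_on_id)
  moreover have "eigen_complement F = (\<Inter>l\<in>F. \<Inter>e\<in>{e. e = l *\<^sub>C T e}. {x. cinner x e = 0})"
    by (auto simp: eigen_complement_def)
  ultimately show ?thesis by (simp add: closed_INT)
qed

lemma
  assumes x: "x \<in> eigen_complement F"
  shows eigen_complement_invariant: "T x \<in> eigen_complement F"
    and eigen_complement_adj_invariant: "adj x \<in> eigen_complement F"
proof -
  have "cinner (T x) e = 0 \<and> cinner (adj x) e = 0" if l: "l \<in> F" and e: "e = l *\<^sub>C T e" for l e
  proof (cases "l = 0")
    case True
    hence "e = 0" using e by simp
    thus ?thesis by simp
  next
    case False
    have e': "e = cnj l *\<^sub>C adj e" using e adj_fixed_iff by blast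
    have 0: "cinner x e = 0" using x l e unfolding eigen_complement_def by blast
    have "l * cinner (T x) e = cinner x (cnj l *\<^sub>C adj e)" by (simp add: cinner_adj cinner_scaleC_right)
    moreover have "cnj l * cinner (adj x) e = cinner x (l *\<^sub>C T e)"
      by (simp add: cinner_adj' cinner_scaleC_right)
    ultimately show ?thesis using 0 e e' False by simp
  qed
  thus "T x \<in> eigen_complement F" "adj x \<in> eigen_complement F" by (auto simp: eigen_complement_def)
qed

text \<open>An eigenvector of the deflated operator lies in the complement, where it is also an eigenvector
  of \<open>T\<close>; were its characteristic value in \<open>F\<close>, it would be orthogonal to itself.\<close>
lemma deflated_char_values:
  "char_values (\<lambda>x. T (orth_proj (eigen_complement F) x)) \<subseteq> char_values T - F"
proof
  note W = csubspace_eigen_complement[of F] closed_eigen_complement[of F]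
  fix z assume "z \<in> char_values (\<lambda>x. T (orth_proj (eigen_complement F) x))"
  then obtain x where x: "x \<noteq> 0" "x = z *\<^sub>C T (orth_proj (eigen_complement F) x)"
    by (auto simp: char_values_def)
  have xW: "x \<in> eigen_complement F"
    by (subst x(2)) (intro csubspace_scaleC[OF W(1)] eigen_complement_invariant orth_proj_in[OF W])
  hence eq: "x = z *\<^sub>C T x" using x(2) by (simp add: orth_proj_of_mem[OF W])
  have "z \<notin> F"
  proof
    assume "z \<in> F"
    hence "cinner x x = 0" using xW eq unfolding eigen_complement_def by blast
    thus False using x(1) by simp
  qed
  with eq x(1) show "z \<in> char_values T - F" unfolding char_values_def by blast
qed

text \<open>The projection onto the complement commutes with \<open>1 - z T\<close>, so the unique solution of
  \<open>y - z T y = u\<close> with \<open>u\<close> in the complement lies in the complement, where both operators agree.\<close>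
lemma deflated_resolvent_powers:
  assumes z: "z \<notin> char_values T" and x: "x \<in> eigen_complement F"
  shows "(inv_resolvent (\<lambda>x. T (orth_proj (eigen_complement F) x)) z ^^ n) x = (inv_resolvent T z ^^ n) x"
proof -
  define W where "W = eigen_complement F"
  note W = csubspace_eigen_complement[of F, folded W_def] closed_eigen_complement[of F, folded W_def]
  note inv = eigen_complement_invariant[of _ F, folded W_def] eigen_complement_adj_invariant[of _ F, folded W_def]
  interpret T1: compact_normal_operator "\<lambda>x. T (orth_proj W x)"
    by (rule compact_normal_compose_proj[OF W inv])
  have z1: "z \<notin> char_values (\<lambda>x. T (orth_proj W x))"
    using deflated_char_values[of F] z by (auto simp: W_def)
  have step: "inv_resolvent T z u \<in> W \<and> inv_resolvent (\<lambda>x. T (orth_proj W x)) z u = inv_resolvent T z u" if u: "u \<in> W" for u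
  proof -
    obtain y where y: "y - z *\<^sub>C T y = u" "inv_resolvent T z u = T y" using inv_resolvent_cases[OF z] by metis
    have "orth_proj W y - z *\<^sub>C T (orth_proj W y) = orth_proj W (y - z *\<^sub>C T y)"
      by (simp add: orth_proj_diff[OF W] orth_proj_scaleC[OF W] orth_proj_commute[OF W inv])
    also have "\<dots> = u" using u y(1) by (simp add: orth_proj_of_mem[OF W])
    finally have "orth_proj W y = y" using y(1) ex1_preimage[OF z] by blast
    hence yW: "y \<in> W" "y - z *\<^sub>C T (orth_proj W y) = u" using orth_proj_in[OF W, of y] y(1) by auto
    from T1.inv_resolvent_eqI[OF z1 yW(2)] show ?thesis
      using y(2) yW(1) inv(1) orth_proj_of_mem[OF W] by simp
  qed
  have "(inv_resolvent T z ^^ n) x \<in> W \<and> (inv_resolvent (\<lambda>x. T (orth_proj W x)) z ^^ n) x = (inv_resolvent T z ^^ n) x"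
    by (induction n) (use x step in \<open>auto simp: W_def\<close>)
  thus ?thesis by (simp add: W_def)
qed

lemma
  shows csubspace_char_space: "csubspace {x. x = l *\<^sub>C T x}"
    and closed_char_space: "closed {x. x = l *\<^sub>C T x}"
proof -
  show "csubspace {x. x = l *\<^sub>C T x}"
  proof (rule csubspaceI)
    fix a x assume "x \<in> {x. x = l *\<^sub>C T x}"
    hence "x = l *\<^sub>C T x" by simp
    moreover have "a *\<^sub>C (l *\<^sub>C T x) = l *\<^sub>C T (a *\<^sub>C x)"
      by (simp add: scaleC_arg scaleC_scaleC mult.commute)
    ultimately show "a *\<^sub>C x \<in> {x. x = l *\<^sub>C T x}" by simp
  qed (auto simp: zero add scaleC.add_right)
  show "closed {x. x = l *\<^sub>C T x}"
    by (intro closed_Collect_eq continuous_on_id bounded_linear.continuous_on[OF scaleC.bounded_linear_right]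
      bounded_linear.continuous_on[OF bounded_linear])
qed

text \<open>Eigenspaces of a normal operator are mutually orthogonal, so subtracting all projections leaves a
  vector orthogonal to each of them.\<close>
lemma minus_projections_in_eigen_complement:
  assumes F: "finite F"
  shows "v - (\<Sum>l\<in>F. orth_proj {x. x = l *\<^sub>C T x} v) \<in> eigen_complement F"
  unfolding eigen_complement_def
proof safe
  fix m e assume m: "m \<in> F" and e: "e = m *\<^sub>C T e"
  have "cinner (orth_proj {x. x = l *\<^sub>C T x} v) e = 0" if "l \<noteq> m" for l
    using orth_proj_in[OF csubspace_char_space closed_char_space, of l v]
    by (intro char_vectors_orthogonal[of _ l e m]) (use that e in auto)
  hence "(\<Sum>l\<in>F. cinner (orth_proj {x. x = l *\<^sub>C T x} v) e) = cinner (orth_proj {x. x = m *\<^sub>C T x} v) e"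
    using F m by (subst sum.remove[OF F m]) (auto intro!: sum.neutral)
  moreover have "cinner (v - orth_proj {x. x = m *\<^sub>C T x} v) e = 0"
    by (rule orth_proj_orthogonal[OF csubspace_char_space closed_char_space]) (use e in simp)
  ultimately show "cinner (v - (\<Sum>l\<in>F. orth_proj {x. x = l *\<^sub>C T x} v)) e = 0"
    by (simp add: cinner.diff_left cinner.sum_left)
qed

lemma resolvent_powers_char_vector:
  assumes z: "z \<notin> char_values T" and e: "e = l *\<^sub>C T e" and l: "l \<noteq> z"
  shows "(inv_resolvent T z ^^ n) e = (1 / (l - z)) ^ n *\<^sub>C e"
proof -
  have "inv_resolvent T z e = T ((l / (l - z)) *\<^sub>C e)"
  proof (rule inv_resolvent_eqI[OF z])
    have "(l / (l - z)) *\<^sub>C e - z *\<^sub>C T ((l / (l - z)) *\<^sub>C e)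
        = (1 / (l - z)) *\<^sub>C (l *\<^sub>C e - z *\<^sub>C (l *\<^sub>C T e))"
      by (simp add: scaleC_arg scaleC.diff_right scaleC_scaleC mult_ac)
    also have "l *\<^sub>C e - z *\<^sub>C (l *\<^sub>C T e) = (l - z) *\<^sub>C e"
      using e by (simp add: scaleC.diff_left)
    finally show "(l / (l - z)) *\<^sub>C e - z *\<^sub>C T ((l / (l - z)) *\<^sub>C e) = e"
      using l by (simp add: scaleC_scaleC scaleC_one)
  qed
  also have "\<dots> = (1 / (l - z)) *\<^sub>C (l *\<^sub>C T e)" by (simp add: scaleC_arg scaleC_scaleC)
  finally have "inv_resolvent T z e = (1 / (l - z)) *\<^sub>C e" using e by simp
  thus ?thesis
    by (induction n) (simp_all add: scaleC_one inv_resolvent_scaleC[OF z] scaleC_scaleC mult.commute)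
qed

lemma inv_resolvent_power_sum:
  assumes z: "z \<notin> char_values T"
  shows "(inv_resolvent T z ^^ n) (x + (\<Sum>i\<in>I. y i)) = (inv_resolvent T z ^^ n) x + (\<Sum>i\<in>I. (inv_resolvent T z ^^ n) (y i))"
  by (induction n)
     (simp_all add: inv_resolvent_add[OF z] linear_sum[OF bounded_linear.linear[OF inv_resolvent_bounded_linear[OF z]]])

text \<open>Split \<open>v\<close> into its components in the eigenspaces of the poles in the disc and a rest \<open>v'\<close>. On an
  eigenvector for \<open>l\<close> the operator \<open>\<Sum> q\<^sub>i A\<^sup>E\<^sup>-\<^sup>i\<^sup>+\<^sup>1\<close> acts as \<open>(l - z0)\<^sup>-\<^sup>E\<^sup>-\<^sup>1\<close> times the value of the
  polynomial at \<open>l - z0\<close>, which is zero. On \<open>v'\<close> the powers of \<open>A\<close> agree with those of the deflated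
  resolvent, which has no singularity in the disc.\<close>
lemma filtered_coefficient_bound:
  assumes r: "r > 0" and z0: "z0 \<notin> char_values T"
    and roots: "\<And>l. l \<in> char_values T \<inter> cball z0 r \<Longrightarrow> poly p (l - z0) = 0"
  obtains C where "C \<ge> 0" "\<And>E. E \<ge> degree p \<Longrightarrow>
    norm (\<Sum>i\<le>E. coeff p i *\<^sub>C (inv_resolvent T z0 ^^ Suc (E - i)) v) \<le> C / r ^ E"
proof -
  define F where "F = char_values T \<inter> cball z0 r"
  define A where "A = inv_resolvent T z0"
  have "F \<subseteq> char_values T \<inter> cball 0 (cmod z0 + r)"
  proof -
    have "cmod l \<le> cmod z0 + r" if "dist z0 l \<le> r" for l
      using that norm_triangle_sub[of l z0] by (simp add: dist_norm norm_minus_commute)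
    thus ?thesis by (auto simp: F_def)
  qed
  hence F: "finite F" using finite_char_values finite_subset by blast
  define vl where "vl l = orth_proj {x. x = l *\<^sub>C T x} v" for l
  define v' where "v' = v - (\<Sum>l\<in>F. vl l)"
  have v': "v' \<in> eigen_complement F" unfolding v'_def vl_def by (rule minus_projections_in_eigen_complement[OF F])
  interpret T1: compact_normal_operator "\<lambda>x. T (orth_proj (eigen_complement F) x)"
    by (rule compact_normal_compose_proj[OF csubspace_eigen_complement closed_eigen_complement
        eigen_complement_invariant eigen_complement_adj_invariant])
  have "cball z0 r \<inter> char_values (\<lambda>x. T (orth_proj (eigen_complement F) x)) = {}"
    using deflated_char_values[of F] by (auto simp: F_def)
  from T1.resolvent_coeff_growth[OF r this, of v'] obtain C
    where C: "C \<ge> 0" "\<And>n. norm ((A ^^ Suc n) v') \<le> C / r ^ n"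
    unfolding deflated_resolvent_powers[OF z0 v'] A_def by blast
  define C' where "C' = (\<Sum>i\<le>degree p. cmod (coeff p i) * (C * r ^ i))"
  show ?thesis
  proof (rule that[of C'])
    show "C' \<ge> 0" unfolding C'_def using C r by (intro sum_nonneg) auto
    fix E assume E: "E \<ge> degree p"
    have kill: "(\<Sum>i\<le>E. coeff p i *\<^sub>C (A ^^ Suc (E - i)) (vl l)) = 0" if l: "l \<in> F" for l
    proof -
      have lz: "l \<noteq> z0" using l z0 by (auto simp: F_def)
      have e: "vl l = l *\<^sub>C T (vl l)"
        using orth_proj_in[OF csubspace_char_space closed_char_space, of l v] by (simp add: vl_def)
      have "coeff p i *\<^sub>C (A ^^ Suc (E - i)) (vl l) = ((1 / (l - z0)) ^ Suc E * (coeff p i * (l - z0) ^ i)) *\<^sub>C vl l"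
        if "i \<le> E" for i
      proof -
        have "(1 / (l - z0)) ^ Suc E * (l - z0) ^ i = (1 / (l - z0)) ^ Suc (E - i)"
        proof -
          have "Suc E = Suc (E - i) + i" using that by simp
          hence "(1 / (l - z0)) ^ Suc E = (1 / (l - z0)) ^ Suc (E - i) * (1 / (l - z0)) ^ i"
            by (metis power_add)
          thus ?thesis using lz by (simp add: power_divide)
        qed
        thus ?thesis
          unfolding A_def resolvent_powers_char_vector[OF z0 e lz] scaleC_scaleC
          by (metis mult.left_commute)
      qed
      hence "(\<Sum>i\<le>E. coeff p i *\<^sub>C (A ^^ Suc (E - i)) (vl l))
          = ((1 / (l - z0)) ^ Suc E * (\<Sum>i\<le>E. coeff p i * (l - z0) ^ i)) *\<^sub>C vl l"
        by (simp add: scaleC.sum_left sum_distrib_left)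
      also have "(\<Sum>i\<le>E. coeff p i * (l - z0) ^ i) = poly p (l - z0)"
        unfolding poly_altdef using E by (intro sum.mono_neutral_right) (auto simp: coeff_eq_0)
      also have "\<dots> = 0" using roots l by (simp add: F_def)
      finally show ?thesis by simp
    qed
    have v: "v = v' + (\<Sum>l\<in>F. vl l)" by (simp add: v'_def)
    have "(\<Sum>i\<le>E. coeff p i *\<^sub>C (A ^^ Suc (E - i)) v)
        = (\<Sum>i\<le>E. coeff p i *\<^sub>C (A ^^ Suc (E - i)) v')
          + (\<Sum>i\<le>E. \<Sum>l\<in>F. coeff p i *\<^sub>C (A ^^ Suc (E - i)) (vl l))"
      by (subst v) (simp only: A_def inv_resolvent_power_sum[OF z0] scaleC.add_right scaleC.sum_right sum.distrib)
    also have "(\<Sum>i\<le>E. \<Sum>l\<in>F. coeff p i *\<^sub>C (A ^^ Suc (E - i)) (vl l)) = 0"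
      by (subst sum.swap) (intro sum.neutral ballI kill)
    finally have "norm (\<Sum>i\<le>E. coeff p i *\<^sub>C (A ^^ Suc (E - i)) v)
        = norm (\<Sum>i\<le>E. coeff p i *\<^sub>C (A ^^ Suc (E - i)) v')" by simp
    also have "(\<Sum>i\<le>E. coeff p i *\<^sub>C (A ^^ Suc (E - i)) v') = (\<Sum>i\<le>degree p. coeff p i *\<^sub>C (A ^^ Suc (E - i)) v')"
      using E by (intro sum.mono_neutral_right) (auto simp: coeff_eq_0)
    also have "norm \<dots> \<le> (\<Sum>i\<le>degree p. cmod (coeff p i) * (C * r ^ i) / r ^ E)"
    proof (rule sum_norm_le)
      fix i assume "i \<in> {..degree p}"
      hence i: "i \<le> E" using E by simp
      have "norm (coeff p i *\<^sub>C (A ^^ Suc (E - i)) v') \<le> cmod (coeff p i) * (C / r ^ (E - i))"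
        unfolding norm_scaleC by (intro mult_left_mono C(2)) auto
      also have "C / r ^ (E - i) = C * r ^ i / r ^ E"
        using i r by (simp add: field_simps power_add[symmetric])
      finally show "norm (coeff p i *\<^sub>C (A ^^ Suc (E - i)) v') \<le> cmod (coeff p i) * (C * r ^ i) / r ^ E"
        by simp
    qed
    also have "\<dots> = C' / r ^ E" by (simp add: C'_def sum_divide_distrib)
    finally show "norm (\<Sum>i\<le>E. coeff p i *\<^sub>C (inv_resolvent T z0 ^^ Suc (E - i)) v) \<le> C' / r ^ E"
      by (simp add: A_def)
  qed
qed

end

section \<open>Normalized denominators\<close>

lemma normalized_polys_iff:
  "Q \<in> normalized_polys z0 N \<longleftrightarrow>
    (\<exists>p. degree p \<le> N \<and> (\<Sum>j\<le>N. (cmod (coeff p j))\<^sup>2) = 1 \<and> Q = (\<lambda>z. poly p (z - z0)))"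
proof
  assume "Q \<in> normalized_polys z0 N"
  then obtain q where q: "(\<Sum>j\<le>N. (cmod (q j))\<^sup>2) = 1" "Q = (\<lambda>z. \<Sum>j\<le>N. q j * (z - z0) ^ j)"
    by (auto simp: normalized_polys_def)
  define p where "p = (\<Sum>j\<le>N. monom (q j) j)"
  have "coeff p j = q j" if "j \<le> N" for j using that by (simp add: p_def coeff_sum)
  moreover have "degree p \<le> N" unfolding p_def
    by (intro degree_sum_le) (auto intro: order_trans[OF degree_monom_le])
  moreover have "Q = (\<lambda>z. poly p (z - z0))" by (simp add: q(2) p_def poly_sum poly_monom)
  ultimately show "\<exists>p. degree p \<le> N \<and> (\<Sum>j\<le>N. (cmod (coeff p j))\<^sup>2) = 1 \<and> Q = (\<lambda>z. poly p (z - z0))"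
    using q(1) by (intro exI[of _ p]) simp
next
  assume "\<exists>p. degree p \<le> N \<and> (\<Sum>j\<le>N. (cmod (coeff p j))\<^sup>2) = 1 \<and> Q = (\<lambda>z. poly p (z - z0))"
  then obtain p where p: "degree p \<le> N" "(\<Sum>j\<le>N. (cmod (coeff p j))\<^sup>2) = 1"
    "Q = (\<lambda>z. poly p (z - z0))" by blast
  have "Q = (\<lambda>z. \<Sum>j\<le>N. coeff p j * (z - z0) ^ j)"
    unfolding p(3) poly_altdef using p(1)
    by (intro ext sum.mono_neutral_left) (auto simp: coeff_eq_0)
  with p(2) show "Q \<in> normalized_polys z0 N" by (auto simp: normalized_polys_def)
qed

text \<open>The minimizer is compared with the normalized polynomial whose roots are the poles in the disc.
  The constant depends on \<open>r\<close> but not on \<open>N\<close> and \<open>E\<close>.\<close>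
lemma (in compact_normal_operator) ls_functional_minimum_bound:
  fixes S :: "complex \<Rightarrow> 'a"
  assumes r: "r > 0" and z0: "z0 \<notin> char_values T"
    and S: "\<And>z. z \<notin> char_values T \<Longrightarrow> S z = inv_resolvent T z v"
  defines "F \<equiv> char_values T \<inter> cball z0 r"
  assumes finF: "finite F"
  obtains C where "C \<ge> 0"
    "\<And>N E Q. card F \<le> N \<Longrightarrow> N \<le> E \<Longrightarrow>
      is_arg_min (ls_functional S z0 E) (\<lambda>P. P \<in> normalized_polys z0 N) Q \<Longrightarrow>
      ls_functional S z0 E Q \<le> C / r ^ E"
proof -
  define p0 where "p0 = (\<Prod>l\<in>F. [:-(l - z0), 1:])"
  define c where "c = sqrt (\<Sum>j\<le>card F. (cmod (coeff p0 j))\<^sup>2)"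
  define p where "p = smult (complex_of_real (1 / c)) p0"
  have lead: "lead_coeff p0 = 1" by (simp add: p0_def lead_coeff_prod)
  have deg0: "degree p0 = card F" by (simp add: p0_def degree_prod_eq_sum_degree)
  have "(cmod (coeff p0 (card F)))\<^sup>2 \<le> (\<Sum>j\<le>card F. (cmod (coeff p0 j))\<^sup>2)"
    by (rule member_le_sum) auto
  hence c: "c > 0" "c\<^sup>2 = (\<Sum>j\<le>card F. (cmod (coeff p0 j))\<^sup>2)"
    using lead deg0 by (auto simp: c_def sum_nonneg)
  have deg: "degree p = card F" using c by (simp add: p_def deg0)
  have "(\<Sum>j\<le>card F. (cmod (coeff p j))\<^sup>2) = (\<Sum>j\<le>card F. (cmod (coeff p0 j))\<^sup>2) / c\<^sup>2"
    by (simp add: p_def norm_mult norm_divide power_mult_distrib power_divide sum_divide_distrib)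
  hence nrm: "(\<Sum>j\<le>card F. (cmod (coeff p j))\<^sup>2) = 1" using c by (metis divide_self power_not_zero less_irrefl)
  have roots: "poly p (l - z0) = 0" if "l \<in> char_values T \<inter> cball z0 r" for l
    using that finF by (auto simp: p_def p0_def poly_prod F_def)
  obtain C where C: "C \<ge> 0" "\<And>E. E \<ge> degree p \<Longrightarrow>
    norm (\<Sum>i\<le>E. coeff p i *\<^sub>C (inv_resolvent T z0 ^^ Suc (E - i)) v) \<le> C / r ^ E"
    using filtered_coefficient_bound[OF r z0 roots, of v] by blast
  show ?thesis
  proof (rule that[OF C(1)])
    fix N E Q assume N: "card F \<le> N" "N \<le> E"
      and Q: "is_arg_min (ls_functional S z0 E) (\<lambda>P. P \<in> normalized_polys z0 N) Q"
    have "(\<Sum>j\<le>N. (cmod (coeff p j))\<^sup>2) = (\<Sum>j\<le>card F. (cmod (coeff p j))\<^sup>2)"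
      using N deg by (intro sum.mono_neutral_right) (auto simp: coeff_eq_0)
    hence "(\<lambda>z. poly p (z - z0)) \<in> normalized_polys z0 N"
      unfolding normalized_polys_iff using deg N nrm by (intro exI[of _ p]) auto
    hence "ls_functional S z0 E Q \<le> ls_functional S z0 E (\<lambda>z. poly p (z - z0))"
      using Q unfolding is_arg_min_linorder by blast
    also have "\<dots> = norm (\<Sum>i\<le>E. coeff p i *\<^sub>C (inv_resolvent T z0 ^^ Suc (E - i)) v)"
      unfolding ls_functional_def by (rule arg_cong[OF taylor_coeff_resolvent[OF z0 S]])
    also have "\<dots> \<le> C / r ^ E" using N deg by (intro C(2)) simp
    finally show "ls_functional S z0 E Q \<le> C / r ^ E" .
  qed
qed

section \<open>Sublevel sets of normalized polynomials\<close>

lemma emeasure_lborel_complex_ball: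
  "R \<ge> 0 \<Longrightarrow> emeasure lborel (ball (c::complex) R) = ennreal (pi * R\<^sup>2)"
  "R \<ge> 0 \<Longrightarrow> emeasure lborel (cball (c::complex) R) = ennreal (pi * R\<^sup>2)"
  by (simp_all add: emeasure_ball emeasure_cball unit_ball_vol_2)

text \<open>A discrete layer-cake bound: the term for the dyadic annulus that contains \<open>w\<close> already dominates.\<close>
lemma inverse_dist_le_dyadic_sum:
  fixes w a :: complex
  assumes "w \<noteq> a" "dist a w < 1"
  shows "ennreal (1 / cmod (w - a)) \<le> (\<Sum>k. ennreal (2 ^ Suc k) * indicator (cball a ((1/2) ^ k)) w)"
proof -
  define t where "t = dist a w"
  have t: "0 < t" "t < 1" using assms by (auto simp: t_def)
  define k where "k = (LEAST k. (1/2) ^ Suc k < t)"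
  obtain n where "(1/2) ^ n < t" using real_arch_pow_inv[of t "1/2"] t by auto
  hence "(1/2) ^ Suc n < t" by (rule le_less_trans[rotated]) simp
  hence k: "(1/2) ^ Suc k < t" unfolding k_def by (rule LeastI)
  have k': "t \<le> (1/2) ^ k"
  proof (cases k)
    case (Suc j)
    hence "\<not> (1/2) ^ Suc j < t" unfolding k_def by (metis lessI not_less_Least)
    thus ?thesis using Suc by simp
  qed (use t in simp)
  have "1 / t \<le> 1 / (1/2) ^ Suc k" using k t by (intro divide_left_mono) auto
  also have "\<dots> = 2 ^ Suc k" by (simp add: power_divide)
  finally have "ennreal (1 / cmod (w - a)) \<le> ennreal (2 ^ Suc k)"
    by (intro ennreal_leI) (simp add: t_def dist_norm norm_minus_commute)
  also have "\<dots> = (\<Sum>i\<in>{k}. ennreal (2 ^ Suc i) * indicator (cball a ((1/2) ^ i)) w)"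
    using k' by (simp add: t_def indicator_def)
  also have "\<dots> \<le> (\<Sum>i. ennreal (2 ^ Suc i) * indicator (cball a ((1/2) ^ i)) w)"
    by (rule sum_le_suminf) auto
  finally show ?thesis .
qed

text \<open>The kernel \<open>1 / |w - a|\<close> is integrable in the plane, uniformly in the position of the pole \<open>a\<close>:
  the disc of radius \<open>2\<^sup>-\<^sup>k\<close> has area \<open>\<pi> 4\<^sup>-\<^sup>k\<close> and carries the weight \<open>2\<^sup>k\<^sup>+\<^sup>1\<close>, for a total of \<open>4 \<pi>\<close>.\<close>
lemma nn_integral_inverse_dist_le:
  fixes a c :: complex
  assumes R: "R \<ge> 0"
  shows "(\<integral>\<^sup>+w. ennreal (1 / cmod (w - a)) * indicator (ball c R) w \<partial>lborel)
    \<le> ennreal (pi * R\<^sup>2 + 4 * pi)"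
proof -
  let ?g = "\<lambda>k w. ennreal (2 ^ Suc k) * indicator (cball a ((1/2) ^ k)) w"
  have [measurable]: "ball c R \<in> sets lborel" "cball a r \<in> sets lborel" for r by simp_all
  have g [measurable]: "?g k \<in> borel_measurable lborel" for k by measurable
  define S where "S w = (\<Sum>k. ?g k w)" for w
  have "ennreal (1 / cmod (w - a)) * indicator (ball c R) w \<le> indicator (ball c R) w + S w" for w
  proof (cases "w \<noteq> a \<and> dist a w < 1")
    case True
    hence "ennreal (1 / cmod (w - a)) \<le> S w" unfolding S_def by (intro inverse_dist_le_dyadic_sum) auto
    thus ?thesis by (auto simp: indicator_def intro: add_increasing)
  next
    case False
    have "1 / cmod (w - a) \<le> 1"
    proof (cases "w = a")
      case False
      with \<open>\<not> (w \<noteq> a \<and> dist a w < 1)\<close> have "cmod (w - a) \<ge> 1"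
        by (simp add: dist_norm norm_minus_commute)
      thus ?thesis by (simp add: divide_le_eq)
    qed simp
    hence "ennreal (1 / cmod (w - a)) \<le> 1" using ennreal_leI by fastforce
    thus ?thesis by (auto simp: indicator_def intro: add_increasing2)
  qed
  hence "(\<integral>\<^sup>+w. ennreal (1 / cmod (w - a)) * indicator (ball c R) w \<partial>lborel)
      \<le> (\<integral>\<^sup>+w. indicator (ball c R) w + (\<Sum>k. ?g k w) \<partial>lborel)"
    unfolding S_def by (rule nn_integral_mono)
  also have "\<dots> = (\<integral>\<^sup>+w. indicator (ball c R) w \<partial>lborel) + (\<integral>\<^sup>+w. (\<Sum>k. ?g k w) \<partial>lborel)"
    by (rule nn_integral_add) measurable
  also have "(\<integral>\<^sup>+w. indicator (ball c R) w \<partial>lborel) = emeasure lborel (ball c R)"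
    by (rule nn_integral_indicator) simp
  also have "(\<integral>\<^sup>+w. (\<Sum>k. ?g k w) \<partial>lborel) = (\<Sum>k. \<integral>\<^sup>+w. ?g k w \<partial>lborel)"
    by (rule nn_integral_suminf) (rule g)
  also have "(\<lambda>k. \<integral>\<^sup>+w. ?g k w \<partial>lborel) = (\<lambda>k. ennreal (2 * pi * (1/2) ^ k))"
  proof
    fix k
    have "(2::real) ^ k * ((1/2) ^ k)\<^sup>2 = (1/2) ^ k"
      by (simp add: power2_eq_square power_divide)
    hence "(2::real) ^ Suc k * (pi * ((1/2) ^ k)\<^sup>2) = 2 * pi * (1/2) ^ k"
      by simp
    thus "(\<integral>\<^sup>+w. ?g k w \<partial>lborel) = ennreal (2 * pi * (1/2) ^ k)"
      by (subst nn_integral_cmult_indicator)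
         (simp_all add: emeasure_lborel_complex_ball ennreal_mult'[symmetric] del: power_Suc)
  qed
  also have "(\<Sum>k. ennreal (2 * pi * (1/2) ^ k)) = ennreal (4 * pi)"
  proof (rule suminf_ennreal_eq)
    have "(\<lambda>k. (1/2::real) ^ k) sums (1 / (1 - 1/2))" by (rule geometric_sums) simp
    from sums_mult[OF this, of "2 * pi"] show "(\<lambda>k. 2 * pi * (1/2) ^ k) sums (4 * pi)" by simp
  qed simp
  also have "emeasure lborel (ball c R) + ennreal (4 * pi) = ennreal (pi * R\<^sup>2 + 4 * pi)"
    using R by (simp add: emeasure_lborel_complex_ball)
  finally show ?thesis .
qed

lemma higher_deriv_poly: "(deriv ^^ n) (poly p) = poly ((pderiv ^^ n) (p :: complex poly))"
proof (induction n)
  case (Suc n)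
  have "deriv (poly ((pderiv ^^ n) p)) = poly (pderiv ((pderiv ^^ n) p))"
    by (intro ext DERIV_imp_deriv poly_DERIV)
  with Suc show ?case by simp
qed simp

text \<open>By Cauchy's inequality the coefficients are bounded by the maximum on the unit circle, and
  \<open>(N + 1) 4\<^sup>-\<^sup>N < 1\<close> for \<open>N > 0\<close>.\<close>
lemma normalized_poly_large_on_disc:
  fixes p :: "complex poly"
  assumes p: "(\<Sum>j\<le>N. (cmod (coeff p j))\<^sup>2) = 1" "degree p \<le> N"
  obtains u where "cmod u \<le> 1" "(1/2) ^ N \<le> cmod (poly p u)"
proof -
  note large = that
  show thesis
  proof (cases "N = 0")
    case True
    hence "(cmod (coeff p 0))\<^sup>2 = 1\<^sup>2" using p by simp
    hence "cmod (poly p 0) = 1" unfolding poly_0_coeff_0 by (rule power2_eq_imp_eq) auto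
    thus ?thesis using that[of 0] True by simp
  next
    case False
    show ?thesis
    proof (rule ccontr)
      assume contra: "\<not> thesis"
      have b: "cmod (poly p u) \<le> (1/2) ^ N" if "cmod (0 - u) = 1" for u
      proof (rule ccontr)
        assume "\<not> cmod (poly p u) \<le> (1/2) ^ N"
        thus False using contra large[of u] that by simp
      qed
      have "cmod (coeff p j) \<le> (1/2) ^ N" for j
      proof -
        have "cmod ((deriv ^^ j) (poly p) 0) \<le> fact j * (1/2) ^ N / 1 ^ j"
          by (rule Cauchy_inequality) (auto intro!: holomorphic_intros continuous_intros b)
        also have "(deriv ^^ j) (poly p) 0 = fact j * coeff p j"
          by (simp add: higher_deriv_poly poly_0_coeff_0 coeff_higher_pderiv pochhammer_fact[symmetric])
        finally show ?thesis by (simp add: norm_mult)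
      qed
      hence "(\<Sum>j\<le>N. (cmod (coeff p j))\<^sup>2) \<le> (\<Sum>j\<le>N. ((1/2) ^ N)\<^sup>2)"
        by (intro sum_mono power_mono) auto
      also have "((1/2::real) ^ N)\<^sup>2 = 1 / 4 ^ N"
        by (simp add: power2_eq_square power_divide flip: power_mult_distrib)
      also have "(\<Sum>j\<le>N. 1 / 4 ^ N) = real (Suc N) / 4 ^ N" by simp
      finally have "4 ^ N \<le> real (Suc N)" using p by (simp add: field_simps)
      moreover have "real (Suc n) < 4 ^ n" if "n > 0" for n
        using that by (induction n rule: nat_induct_non_zero) auto
      ultimately show False using False by (metis not_le neq0_conv)
    qed
  qed
qed

text \<open>The inequality of arithmetic and geometric means, obtained by multiplying the inequalities
  \<open>t \<le> exp (t - 1)\<close> for \<open>t = x\<^sub>i / B\<close>.\<close>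
lemma sum_ge_of_prod_gt:
  fixes x :: "'b \<Rightarrow> real" and B :: real
  assumes "finite I" "\<And>i. i \<in> I \<Longrightarrow> x i \<ge> 0" and B: "B > 0" and "(\<Prod>i\<in>I. x i) > B ^ card I"
  shows "card I * B < (\<Sum>i\<in>I. x i)"
proof -
  have "1 < (\<Prod>i\<in>I. x i) / B ^ card I" using assms by simp
  also have "\<dots> = (\<Prod>i\<in>I. x i / B)" by (simp add: prod_dividef)
  also have "\<dots> \<le> (\<Prod>i\<in>I. exp (x i / B - 1))"
  proof (rule prod_mono)
    fix i assume "i \<in> I"
    thus "0 \<le> x i / B \<and> x i / B \<le> exp (x i / B - 1)"
      using assms exp_ge_add_one_self[of "x i / B - 1"] by simp
  qed
  also have "\<dots> = exp ((\<Sum>i\<in>I. x i) / B - card I)"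
    using assms(1) by (simp add: exp_sum sum_subtractf sum_divide_distrib flip: exp_sum)
  finally show ?thesis using B by (simp add: field_simps)
qed

text \<open>Let \<open>u\<close> be a point of the closed unit disc where the polynomial is at least \<open>2\<^sup>-\<^sup>N\<close>. Comparing the linear
  factors at \<open>w = z - z0\<close> and at \<open>u\<close>, smallness at \<open>w\<close> forces the product of the numbers
  \<open>(1 + |\<rho>\<^sub>i|) / |w - \<rho>\<^sub>i|\<close> over the roots to exceed \<open>B\<^sup>N\<close>, hence their mean to exceed \<open>B\<close>. The mean is at
  most that of \<open>1 + (1 + R) / |w - \<rho>\<^sub>i|\<close>, whose integral over the disc is bounded
  independently of the number and position of the roots, and Markov's inequality applies. Taking the
  mean rather than a union over the roots is what makes the bound independent of the degree.\<close>
lemma sublevel_set_normalized_poly: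
  fixes p :: "complex poly"
  assumes p: "(\<Sum>j\<le>N. (cmod (coeff p j))\<^sup>2) = 1" "degree p \<le> N" and B: "B \<ge> 1" and R: "R > 0"
  shows "emeasure lborel {z \<in> ball z0 R. cmod (poly p (z - z0)) * (2 * B) ^ N < 1}
    \<le> ennreal ((pi * R\<^sup>2 + (1 + R) * (pi * R\<^sup>2 + 4 * pi)) / B)"
proof -
  define n where "n = degree p"
  define K where "K = pi * R\<^sup>2 + (1 + R) * (pi * R\<^sup>2 + 4 * pi)"
  obtain \<rho> where \<rho>: "smult (lead_coeff p) (\<Prod>i<n. [:-\<rho> i, 1:]) = p"
    using complex_poly_decompose' unfolding n_def by blast
  have poly_p: "poly p w = lead_coeff p * (\<Prod>i<n. w - \<rho> i)" for w
    by (subst \<rho>[symmetric]) (simp add: poly_prod)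
  obtain u where u: "cmod u \<le> 1" "(1/2) ^ N \<le> cmod (poly p u)"
    using normalized_poly_large_on_disc[OF p] by blast
  define a where "a i = z0 + \<rho> i" for i
  define h where "h z = (\<Sum>i<n. 1 + (1 + R) * (1 / cmod (z - a i)))" for z
  define Y where "Y = {z \<in> ball z0 R. 1 \<le> ennreal (1 / (n * B)) * ennreal (h z)}"
  have n_B: "n > 0 \<Longrightarrow> n * B > 0" using B by simp
  have main: "n > 0 \<and> n * B < h z"
    if z: "z \<in> ball z0 R" and small: "cmod (poly p (z - z0)) * (2 * B) ^ N < 1" and nr: "z \<notin> a ` {..<n}" for z
  proof -
    define w where "w = z - z0"
    have wR: "cmod w < R" using z by (simp add: w_def dist_norm norm_minus_commute)
    have w\<rho>: "w - \<rho> i = z - a i" "w \<noteq> \<rho> i" if "i < n" for i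
      using nr that by (auto simp: w_def a_def image_iff diff_eq_eq add.commute)
    define x where "x i = (1 + cmod (\<rho> i)) / cmod (w - \<rho> i)" for i
    have x0: "x i \<ge> 0" for i by (simp add: x_def)
    have "(\<Prod>i<n. cmod (u - \<rho> i)) \<le> (\<Prod>i<n. 1 + cmod (\<rho> i))"
      using u(1) by (intro prod_mono) (auto intro: order_trans[OF norm_triangle_ineq4])
    hence "cmod (poly p u) \<le> cmod (lead_coeff p) * (\<Prod>i<n. 1 + cmod (\<rho> i))"
      unfolding poly_p by (simp add: norm_mult prod_norm mult_left_mono)
    also have "(\<Prod>i<n. 1 + cmod (\<rho> i)) = (\<Prod>i<n. x i) * (\<Prod>i<n. cmod (w - \<rho> i))"
      unfolding prod.distrib[symmetric] using w\<rho>(2) by (intro prod.cong) (auto simp: x_def)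
    also have "cmod (lead_coeff p) * \<dots> = (\<Prod>i<n. x i) * cmod (poly p w)"
      unfolding poly_p by (simp add: norm_mult prod_norm)
    finally have "(1/2) ^ N \<le> (\<Prod>i<n. x i) * cmod (poly p w)" using u(2) by simp
    hence "(1/2) ^ N * (2 * B) ^ N \<le> (\<Prod>i<n. x i) * (cmod (poly p w) * (2 * B) ^ N)"
      using B by (simp add: mult_right_mono mult.assoc[symmetric])
    also have "(1/2) ^ N * (2 * B) ^ N = B ^ N" by (subst power_mult_distrib[symmetric]) simp
    finally have le: "B ^ N \<le> (\<Prod>i<n. x i) * (cmod (poly p w) * (2 * B) ^ N)" .
    have "(\<Prod>i<n. x i) > 0"
      using le B by (smt (verit) mult_eq_0_iff prod_nonneg x0 zero_less_power)
    hence "(\<Prod>i<n. x i) * (cmod (poly p w) * (2 * B) ^ N) < (\<Prod>i<n. x i) * 1"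
      using small by (intro mult_strict_left_mono) (simp_all add: w_def)
    hence "B ^ N < (\<Prod>i<n. x i)" using le by simp
    moreover have "B ^ n \<le> B ^ N" using B p(2) by (intro power_increasing) (auto simp: n_def)
    ultimately have gt: "B ^ n < (\<Prod>i<n. x i)" by simp
    hence n0: "n > 0" by (intro Nat.gr0I) simp
    have "n * B < (\<Sum>i<n. x i)"
      using sum_ge_of_prod_gt[where I = "{..<n}" and x = x and B = B] gt x0 B by simp
    also have "\<dots> \<le> h z" unfolding h_def
    proof (rule sum_mono)
      fix i assume "i \<in> {..<n}"
      hence i: "w - \<rho> i = z - a i" "cmod (w - \<rho> i) > 0" using w\<rho>[of i] by auto
      have "1 + cmod (\<rho> i) \<le> cmod (w - \<rho> i) + (1 + R)"
        using wR norm_triangle_sub[of "\<rho> i" w] by (simp add: norm_minus_commute)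
      hence "x i \<le> (cmod (w - \<rho> i) + (1 + R)) / cmod (w - \<rho> i)"
        unfolding x_def by (intro divide_right_mono) auto
      also have "\<dots> = 1 + (1 + R) * (1 / cmod (z - a i))" using i by (simp add: add_divide_distrib)
      finally show "x i \<le> 1 + (1 + R) * (1 / cmod (z - a i))" .
    qed
    finally show ?thesis using n0 by blast
  qed
  have sub: "{z \<in> ball z0 R. cmod (poly p (z - z0)) * (2 * B) ^ N < 1} \<subseteq> Y \<union> a ` {..<n}"
  proof safe
    fix z assume z: "z \<in> ball z0 R" "cmod (poly p (z - z0)) * (2 * B) ^ N < 1" "z \<notin> a ` {..<n}"
    from main[OF this] have nh: "n > 0" "n * B < h z" by auto
    have "1 \<le> 1 / (n * B) * h z" using n_B nh by simp
    hence "ennreal 1 \<le> ennreal (1 / (n * B) * h z)" by (rule ennreal_leI)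
    also have "\<dots> = ennreal (1 / (n * B)) * ennreal (h z)"
      by (rule ennreal_mult') (use B in simp)
    finally show "z \<in> Y" using z(1) by (simp add: Y_def)
  qed
  have [measurable]: "ball z0 R \<in> sets lborel" by simp
  have meas: "(\<lambda>z. ennreal (h z) * indicator (ball z0 R) z) \<in> borel_measurable lborel"
    unfolding h_def by measurable
  have Y_sets: "Y \<in> sets lborel"
    unfolding Y_def h_def by measurable
  have "emeasure lborel {z \<in> ball z0 R. cmod (poly p (z - z0)) * (2 * B) ^ N < 1} \<le> emeasure lborel (Y \<union> a ` {..<n})"
  proof (rule emeasure_mono[OF sub sets.Un[OF Y_sets]])
    show "a ` {..<n} \<in> sets lborel" by (simp add: borel_closed finite_imp_closed)
  qed
  also have "\<dots> = emeasure lborel Y"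
    by (intro emeasure_Un_null_set Y_sets finite_imp_null_set_lborel) simp
  also have "\<dots> \<le> ennreal (1 / (n * B)) * (\<integral>\<^sup>+z. ennreal (h z) * indicator (ball z0 R) z \<partial>lborel)"
    unfolding Y_def by (rule nn_integral_Markov_inequality[OF meas]) simp
  also have "(\<integral>\<^sup>+z. ennreal (h z) * indicator (ball z0 R) z \<partial>lborel)
      = (\<Sum>i<n. \<integral>\<^sup>+z. ennreal (1 + (1 + R) * (1 / cmod (z - a i))) * indicator (ball z0 R) z \<partial>lborel)"
    unfolding h_def using R
    by (subst nn_integral_sum[symmetric])
       (auto simp: sum_ennreal[symmetric] sum_distrib_right intro!: nn_integral_cong)
  also have "\<dots> \<le> (\<Sum>i<n. ennreal K)"
  proof (rule sum_mono)
    fix i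
    have "(\<integral>\<^sup>+z. ennreal (1 + (1 + R) * (1 / cmod (z - a i))) * indicator (ball z0 R) z \<partial>lborel)
        = (\<integral>\<^sup>+z. indicator (ball z0 R) z + ennreal (1 + R) * (ennreal (1 / cmod (z - a i)) * indicator (ball z0 R) z) \<partial>lborel)"
    proof (rule nn_integral_cong)
      fix z
      have "ennreal (1 + c * t) = 1 + ennreal c * ennreal t" if "c \<ge> 0" "t \<ge> 0" for c t
        using that by (simp add: ennreal_mult')
      from this[of "1 + R" "1 / cmod (z - a i)"] R
      have "ennreal (1 + (1 + R) * (1 / cmod (z - a i))) = 1 + ennreal (1 + R) * ennreal (1 / cmod (z - a i))"
        by simp
      thus "ennreal (1 + (1 + R) * (1 / cmod (z - a i))) * indicator (ball z0 R) z
          = indicator (ball z0 R) z + ennreal (1 + R) * (ennreal (1 / cmod (z - a i)) * indicator (ball z0 R) z)"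
        by (simp only: distrib_right mult_1 mult.assoc)
    qed
    also have "\<dots> = emeasure lborel (ball z0 R)
        + ennreal (1 + R) * (\<integral>\<^sup>+z. ennreal (1 / cmod (z - a i)) * indicator (ball z0 R) z \<partial>lborel)"
      by (subst nn_integral_add) (auto simp: nn_integral_cmult)
    also have "\<dots> \<le> ennreal (pi * R\<^sup>2) + ennreal (1 + R) * ennreal (pi * R\<^sup>2 + 4 * pi)"
      using R by (intro add_mono mult_left_mono nn_integral_inverse_dist_le)
                 (auto simp: emeasure_lborel_complex_ball)
    also have "\<dots> = ennreal (pi * R\<^sup>2) + ennreal ((1 + R) * (pi * R\<^sup>2 + 4 * pi))"
      by (rule arg_cong[OF ennreal_mult'[symmetric]]) (use R in simp)
    also have "\<dots> = ennreal K" unfolding K_def using R by (intro ennreal_plus[symmetric]) auto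
    finally show "(\<integral>\<^sup>+z. ennreal (1 + (1 + R) * (1 / cmod (z - a i))) * indicator (ball z0 R) z \<partial>lborel) \<le> ennreal K" .
  qed
  also have "(\<Sum>i<n. ennreal K) = ennreal (n * K)"
    by (simp add: ennreal_of_nat_eq_real_of_nat ennreal_mult'[symmetric])
  also have "ennreal (1 / (n * B)) * ennreal (n * K) = ennreal (1 / (n * B) * (n * K))"
    by (rule ennreal_mult'[symmetric]) (use B in simp)
  also have "\<dots> \<le> ennreal (K / B)"
  proof (rule ennreal_leI)
    have "K \<ge> 0" using R by (simp add: K_def)
    thus "1 / (n * B) * (n * K) \<le> K / B" using B by (cases "n = 0") auto
  qed
  finally show ?thesis
    unfolding K_def by (simp add: mult_left_mono)
qed

section \<open>Poles of the solution map\<close>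

context compact_normal_operator
begin

lemma finite_char_values_cball: "finite (char_values T \<inter> cball z0 r)"
proof (rule finite_subset[OF _ finite_char_values[of "cmod z0 + r"]])
  have "cmod l \<le> cmod z0 + r" if "dist z0 l \<le> r" for l
    using that norm_triangle_sub[of l z0] by (simp add: dist_norm norm_minus_commute)
  thus "char_values T \<inter> cball z0 r \<subseteq> char_values T \<inter> cball 0 (cmod z0 + r)" by auto
qed

text \<open>The characteristic values have no finite limit point.\<close>
lemma eventually_regular: "eventually (\<lambda>z. z \<notin> char_values T) (at l)"
proof -
  define F where "F = char_values T \<inter> cball l 1 - {l}"
  have "finite F" unfolding F_def using finite_char_values_cball by blast
  hence "open (ball l 1 - F)" by (intro open_Diff open_ball finite_imp_closed)
  moreover have "l \<in> ball l 1 - F" by (simp add: F_def)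
  ultimately have "eventually (\<lambda>z. z \<in> ball l 1 - F) (at l)" by (rule eventually_at_in_open')
  moreover have "eventually (\<lambda>z. z \<noteq> l) (at l)" by (simp add: eventually_at_filter)
  ultimately show ?thesis by eventually_elim (auto simp: F_def)
qed

lemma cinner_resolvent_char_vector:
  assumes z: "z \<notin> char_values T" and p: "p = l *\<^sub>C T p"
  shows "(l - z) * cinner (inv_resolvent T z v) p = cinner v p"
proof -
  obtain y where y: "y - z *\<^sub>C T y = v" "inv_resolvent T z v = T y" using inv_resolvent_cases[OF z] by metis
  have p': "p = cnj l *\<^sub>C adj p" using p adj_fixed_iff by blast
  have "cinner y p = cinner y (cnj l *\<^sub>C adj p)" using p' by simp
  also have "\<dots> = l * cinner (T y) p" by (simp add: cinner_scaleC_right cinner_adj)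
  finally have "cinner y p = l * cinner (T y) p" .
  moreover have "cinner v p = cinner y p - z * cinner (T y) p"
    by (subst y(1)[symmetric]) (simp add: cinner.diff_left cinner_scaleC_left)
  ultimately show ?thesis unfolding y(2) by (simp add: algebra_simps)
qed

text \<open>Pairing with the component \<open>p\<close> of \<open>v\<close> in the eigenspace gives \<open>(l - z) \<langle>S(z), p\<rangle> = |p|\<^sup>2\<close>, so \<open>S\<close>
  blows up at \<open>l\<close> when \<open>p\<close> is nonzero; elsewhere \<open>S\<close> is continuous.\<close>
lemma is_pole_resolvent_iff:
  fixes S :: "complex \<Rightarrow> 'a"
  assumes S: "\<And>z. z \<notin> char_values T \<Longrightarrow> S z = inv_resolvent T z v"
    and proj: "l \<in> char_values T \<Longrightarrow> orth_proj {x. x = l *\<^sub>C T x} v \<noteq> 0"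
  shows "is_pole S l \<longleftrightarrow> l \<in> char_values T"
proof
  assume l: "l \<in> char_values T"
  define p where "p = orth_proj {x. x = l *\<^sub>C T x} v"
  note E = csubspace_char_space[of l] closed_char_space[of l]
  have p: "p = l *\<^sub>C T p" using orth_proj_in[OF E, of v] by (simp add: p_def)
  have p0: "norm p > 0" using proj[OF l] by (simp add: p_def)
  have "cinner (v - p) p = 0" unfolding p_def by (rule orth_proj_orthogonal[OF E orth_proj_in[OF E]])
  hence vp: "cinner v p = cinner p p" by (simp add: cinner.diff_left)
  have "eventually (\<lambda>z. r \<le> norm (S z)) (at l)" if r: "r > 0" for r
  proof -
    have "eventually (\<lambda>z. dist z l < norm p / r) (at l)"
      using p0 r by (intro eventually_at_ball[of _ l UNIV, simplified, THEN eventually_mono])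
        (auto simp: dist_commute)
    with eventually_regular[of l] show ?thesis
    proof eventually_elim
      case (elim z)
      have "(norm p)\<^sup>2 = cmod ((l - z) * cinner (S z) p)"
        using cinner_resolvent_char_vector[OF elim(1) p, of v] elim(1) vp
        by (simp add: S cinner_self norm_power)
      also have "\<dots> \<le> dist z l * (norm (S z) * norm p)"
        by (simp add: norm_mult dist_norm norm_minus_commute mult_left_mono cmod_cinner_le)
      also have "\<dots> \<le> norm p / r * (norm (S z) * norm p)"
        using elim(2) by (intro mult_right_mono) auto
      finally have "norm p * norm p * r \<le> norm p * norm p * norm (S z)"
        using r by (simp add: power2_eq_square field_simps)
      thus ?case using p0 by simp
    qed
  qed
  thus "is_pole S l" unfolding is_pole_def by (subst filterlim_at_infinity[of 0]) auto
next
  assume pole: "is_pole S l"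
  show "l \<in> char_values T"
  proof (rule ccontr)
    assume l: "l \<notin> char_values T"
    have "isCont (\<lambda>y. inv_resolvent T y v) l" by (rule continuous_inv_resolvent[OF l continuous_const])
    hence "((\<lambda>y. inv_resolvent T y v) \<longlongrightarrow> inv_resolvent T l v) (at l)" by (simp add: isCont_def)
    moreover have "eventually (\<lambda>z. inv_resolvent T z v = S z) (at l)"
      using eventually_regular by eventually_elim (simp add: S)
    ultimately have "(S \<longlongrightarrow> inv_resolvent T l v) (at l)" by (rule Lim_transform_eventually)
    with pole show False unfolding is_pole_def
      by (metis not_tendsto_and_filterlim_at_infinity at_neq_bot)
  qed
qed

section \<open>The error away from the poles\<close>

text \<open>Multiplying the error by \<open>|Q|\<close> removes the zeros of the denominator, and the result decays
  geometrically outside fixed neighbourhoods of the poles. The factor \<open>1 + R\<close> in the constant covers both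
  \<open>E = M\<close>, where \<open>R\<^sup>M\<^sup>+\<^sup>1 / r\<^sup>E = R (R/r)\<^sup>M\<close>, and \<open>E = M + 1\<close>, where it is \<open>(R/r)\<^sup>M\<^sup>+\<^sup>1\<close>.\<close>
lemma weighted_error_bound:
  fixes S :: "complex \<Rightarrow> 'a"
  assumes z0: "z0 \<notin> char_values T" and S: "\<And>z. z \<notin> char_values T \<Longrightarrow> S z = inv_resolvent T z v"
    and R: "R > 0" and r: "r > R" and \<delta>: "\<delta> > 0"
  obtains C where "\<And>M N Q z. card (char_values T \<inter> cball z0 r) \<le> N \<Longrightarrow> N \<le> Suc M \<Longrightarrow>
      fast_LS_Pade_denominator S z0 M N (max M N) Q \<Longrightarrow> z \<in> ball z0 R \<Longrightarrow>
      z \<notin> (\<Union>l\<in>char_values T \<inter> cball z0 R. ball l \<delta>) \<Longrightarrow> Q z \<noteq> 0 \<Longrightarrow>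
      cmod (Q z) * norm (S z - fast_LS_Pade S z0 M Q z) \<le> C * (R / r) ^ M"
proof -
  define K where "K = cball z0 R - (\<Union>l\<in>char_values T \<inter> cball z0 R. ball l \<delta>)"
  have K: "compact K" unfolding K_def by (intro compact_diff compact_cball) auto
  have "K \<inter> char_values T = {}" unfolding K_def using \<delta> by (auto simp: dist_commute)
  from inv_resolvent_uniform_bound[OF K this]
  obtain C1 where C1: "C1 > 0" "\<And>z x. z \<in> K \<Longrightarrow> norm (inv_resolvent T z x) \<le> C1 * norm x" by blast
  have Kreg: "z \<notin> char_values T" if "z \<in> K" for z
    using \<open>K \<inter> char_values T = {}\<close> that by blast
  have r0: "r > 0" using R r by simp
  obtain C2 where C2: "C2 \<ge> 0" "\<And>N E Q. card (char_values T \<inter> cball z0 r) \<le> N \<Longrightarrow> N \<le> E \<Longrightarrow>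
      is_arg_min (ls_functional S z0 E) (\<lambda>P. P \<in> normalized_polys z0 N) Q \<Longrightarrow>
      ls_functional S z0 E Q \<le> C2 / r ^ E"
    using ls_functional_minimum_bound[OF r0 z0 S finite_char_values_cball] by blast
  define C where "C = (1 + (1 + R) * C1) * C2 * (1 + R)"
  show ?thesis
  proof (rule that[of C])
    fix M N Q z assume N: "card (char_values T \<inter> cball z0 r) \<le> N" "N \<le> Suc M"
      and Q: "fast_LS_Pade_denominator S z0 M N (max M N) Q" and z: "z \<in> ball z0 R"
      and zU: "z \<notin> (\<Union>l\<in>char_values T \<inter> cball z0 R. ball l \<delta>)" and Qz: "Q z \<noteq> 0"
    have zK: "z \<in> K" using z zU by (simp add: K_def)
    have am: "is_arg_min (ls_functional S z0 (max M N)) (\<lambda>P. P \<in> normalized_polys z0 N) Q"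
      using Q by (simp add: fast_LS_Pade_denominator_def)
    hence "Q \<in> normalized_polys z0 N" by (simp add: is_arg_min_def)
    then obtain p where p: "degree p \<le> N" "Q = (\<lambda>z. poly p (z - z0))"
      unfolding normalized_polys_iff by blast
    let ?P = "fast_LS_Pade_numerator S z0 M Q z"
    have ls: "0 \<le> ls_functional S z0 (max M N) Q" by (simp add: ls_functional_def)
    have zR: "cmod (z - z0) \<le> R" using z by (simp add: dist_norm norm_minus_commute)
    have "S z = (1 / Q z) *\<^sub>C (Q z *\<^sub>C S z)" using Qz by (simp add: scaleC_scaleC scaleC_one)
    hence "S z - fast_LS_Pade S z0 M Q z = (1 / Q z) *\<^sub>C (Q z *\<^sub>C S z - ?P)"
      by (simp add: fast_LS_Pade_def scaleC.diff_right)
    hence "cmod (Q z) * norm (S z - fast_LS_Pade S z0 M Q z) = norm (Q z *\<^sub>C S z - ?P)"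
      using Qz by (simp add: norm_scaleC norm_divide)
    also have "\<dots> \<le> cmod (z - z0) ^ Suc M *
        ((1 + (1 + cmod (z - z0)) * C1) * ls_functional S z0 (max M N) Q)"
      unfolding p(2) using C1 zK
      by (intro remainder_bound[OF Kreg[OF zK] z0 S p(1) N(2)]) auto
    also have "\<dots> \<le> R ^ Suc M * ((1 + (1 + R) * C1) * (C2 / r ^ max M N))"
      using zR C1(1) C2(1) R ls C2(2)[OF N(1) _ am]
      by (intro mult_mono power_mono add_mono order_refl mult_nonneg_nonneg add_nonneg_nonneg) auto
    also have "\<dots> = (1 + (1 + R) * C1) * C2 * (R ^ Suc M / r ^ max M N)" by simp
    also have "\<dots> \<le> (1 + (1 + R) * C1) * C2 * ((1 + R) * (R / r) ^ M)"
    proof (rule mult_left_mono)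
      show "R ^ Suc M / r ^ max M N \<le> (1 + R) * (R / r) ^ M"
      proof (cases "N \<le> M")
        case True
        hence "R ^ Suc M / r ^ max M N = R * (R / r) ^ M" by (simp add: max_def power_divide)
        thus ?thesis using R r0 by (simp add: mult_right_mono)
      next
        case False
        hence "R ^ Suc M / r ^ max M N = (R / r) * (R / r) ^ M"
          using N(2) by (simp add: max_def power_divide le_Suc_eq)
        moreover have "R / r \<le> 1" using r r0 by simp
        hence "R / r \<le> 1 + R" using R by linarith
        hence "(R / r) * (R / r) ^ M \<le> (1 + R) * (R / r) ^ M"
          using R r0 by (intro mult_right_mono) auto
        ultimately show ?thesis by simp
      qed
      show "0 \<le> (1 + (1 + R) * C1) * C2" using C1 C2 R by simp
    qed
    finally show "cmod (Q z) * norm (S z - fast_LS_Pade S z0 M Q z) \<le> C * (R / r) ^ M"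
      by (simp add: C_def mult.assoc)
  qed
qed

text \<open>The error set is covered by two open sets: the discs of radius \<open>\<delta>\<close> around the poles, and the set
  where \<open>|Q| < (2B)\<^sup>-\<^sup>N\<close>, which contains every other point of it once \<open>(R/r)\<^sup>M (2B)\<^sup>N\<close> is small.\<close>
lemma error_set_measure_bound:
  fixes S :: "complex \<Rightarrow> 'a"
  assumes z0: "z0 \<notin> char_values T" and S: "\<And>z. z \<notin> char_values T \<Longrightarrow> S z = inv_resolvent T z v"
    and R: "R > 0" and r: "r > R" and \<delta>: "\<delta> > 0" and B: "B \<ge> 1" and \<epsilon>: "\<epsilon> > 0"
    and NM: "eventually (\<lambda>k. N k \<le> Suc (M k)) sequentially"
    and Nr: "eventually (\<lambda>k. card (char_values T \<inter> cball z0 r) \<le> N k) sequentially"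
    and Q: "eventually (\<lambda>k. fast_LS_Pade_denominator S z0 (M k) (N k) (max (M k) (N k)) (Q k)) sequentially"
    and decay: "(\<lambda>k. (R / r) ^ M k * (2 * B) ^ N k) \<longlonglongrightarrow> 0"
  shows "eventually (\<lambda>k. emeasure lebesgue
            {z \<in> ball z0 R. z \<notin> char_values T \<and> Q k z \<noteq> 0 \<and>
               norm (S z - fast_LS_Pade S z0 (M k) (Q k) z) > \<epsilon>}
      \<le> ennreal (card (char_values T \<inter> cball z0 R) * (pi * \<delta>\<^sup>2)
          + (pi * R\<^sup>2 + (1 + R) * (pi * R\<^sup>2 + 4 * pi)) / B)) sequentially"
proof -
  define F where "F = char_values T \<inter> cball z0 R"
  have F: "finite F" unfolding F_def by (rule finite_char_values_cball)
  define K where "K = pi * R\<^sup>2 + (1 + R) * (pi * R\<^sup>2 + 4 * pi)"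
  obtain C where C: "\<And>M N Q z. card (char_values T \<inter> cball z0 r) \<le> N \<Longrightarrow> N \<le> Suc M \<Longrightarrow>
      fast_LS_Pade_denominator S z0 M N (max M N) Q \<Longrightarrow> z \<in> ball z0 R \<Longrightarrow>
      z \<notin> (\<Union>l\<in>F. ball l \<delta>) \<Longrightarrow> Q z \<noteq> 0 \<Longrightarrow>
      cmod (Q z) * norm (S z - fast_LS_Pade S z0 M Q z) \<le> C * (R / r) ^ M"
    using weighted_error_bound[OF z0 S R r \<delta>] unfolding F_def by blast
  have "(\<lambda>k. C * ((R / r) ^ M k * (2 * B) ^ N k)) \<longlonglongrightarrow> C * 0"
    by (intro tendsto_mult_left decay)
  hence "eventually (\<lambda>k. C * ((R / r) ^ M k * (2 * B) ^ N k) < \<epsilon>) sequentially"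
    using \<epsilon> by (intro order_tendstoD) simp
  with NM Nr Q show ?thesis
  proof eventually_elim
    case (elim k)
    define X where "X = {z \<in> ball z0 R. cmod (Q k z) * (2 * B) ^ N k < 1}"
    have "Q k \<in> normalized_polys z0 (N k)"
      using elim(3) by (simp add: fast_LS_Pade_denominator_def is_arg_min_def)
    then obtain p where p: "degree p \<le> N k" "(\<Sum>j\<le>N k. (cmod (coeff p j))\<^sup>2) = 1"
      "Q k = (\<lambda>z. poly p (z - z0))" unfolding normalized_polys_iff by blast
    have X: "emeasure lborel X \<le> ennreal (K / B)"
      unfolding X_def p(3) K_def by (rule sublevel_set_normalized_poly[OF p(2,1) B R])
    have "X = ball z0 R \<inter> {z. cmod (poly p (z - z0)) * (2 * B) ^ N k < 1}"
      by (auto simp: X_def p(3))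
    moreover have "open \<dots>"
      by (intro open_Int open_ball open_Collect_less continuous_intros)
    ultimately have Xs: "X \<in> sets lborel" by simp
    have U: "emeasure lborel (\<Union>l\<in>F. ball l \<delta>) \<le> ennreal (card F * (pi * \<delta>\<^sup>2))"
    proof -
      have "emeasure lborel (\<Union>l\<in>F. ball l \<delta>) \<le> (\<Sum>l\<in>F. emeasure lborel (ball l \<delta>))"
        using F by (intro emeasure_subadditive_finite) auto
      also have "\<dots> = ennreal (card F * (pi * \<delta>\<^sup>2))"
        using \<delta> by (simp add: emeasure_lborel_complex_ball ennreal_mult' ennreal_of_nat_eq_real_of_nat)
      finally show ?thesis .
    qed
    have sub: "{z \<in> ball z0 R. z \<notin> char_values T \<and> Q k z \<noteq> 0 \<and>
               norm (S z - fast_LS_Pade S z0 (M k) (Q k) z) > \<epsilon>} \<subseteq> (\<Union>l\<in>F. ball l \<delta>) \<union> X"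
    proof (rule subsetI, rule UnCI)
      fix z assume "z \<in> {z \<in> ball z0 R. z \<notin> char_values T \<and> Q k z \<noteq> 0 \<and>
               norm (S z - fast_LS_Pade S z0 (M k) (Q k) z) > \<epsilon>}" and nX: "z \<notin> X"
      hence z: "z \<in> ball z0 R" "Q k z \<noteq> 0" "norm (S z - fast_LS_Pade S z0 (M k) (Q k) z) > \<epsilon>" by auto
      show "z \<in> (\<Union>l\<in>F. ball l \<delta>)"
      proof (rule ccontr)
        assume "z \<notin> (\<Union>l\<in>F. ball l \<delta>)"
        from C[OF elim(2,1,3) z(1) this z(2)]
        have "cmod (Q k z) * \<epsilon> \<le> C * (R / r) ^ M k"
          using z(3) by (meson less_imp_le mult_left_mono norm_ge_zero order_trans)
        hence "cmod (Q k z) * \<epsilon> * (2 * B) ^ N k \<le> C * (R / r) ^ M k * (2 * B) ^ N k"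
          using B by (intro mult_right_mono) auto
        also have "\<dots> < \<epsilon>" using elim(4) by (simp add: mult.assoc)
        finally have "\<epsilon> * (cmod (Q k z) * (2 * B) ^ N k) < \<epsilon> * 1" by (simp add: mult_ac)
        hence "cmod (Q k z) * (2 * B) ^ N k < 1" using \<epsilon> by (simp only: mult_less_cancel_left_pos)
        thus False using nX z(1) by (simp add: X_def)
      qed
    qed
    have UX: "(\<Union>l\<in>F. ball l \<delta>) \<in> sets lborel" by (simp add: open_UN)
    have "emeasure lebesgue {z \<in> ball z0 R. z \<notin> char_values T \<and> Q k z \<noteq> 0 \<and>
               norm (S z - fast_LS_Pade S z0 (M k) (Q k) z) > \<epsilon>}
        \<le> emeasure lebesgue ((\<Union>l\<in>F. ball l \<delta>) \<union> X)"
      using UX Xs by (intro emeasure_mono[OF sub] sets_completionI_sets sets.Un)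
    also have "\<dots> = emeasure lborel ((\<Union>l\<in>F. ball l \<delta>) \<union> X)"
      using UX Xs by simp
    also have "\<dots> \<le> emeasure lborel (\<Union>l\<in>F. ball l \<delta>) + emeasure lborel X"
      by (rule emeasure_subadditive[OF UX Xs])
    also have "\<dots> \<le> ennreal (card F * (pi * \<delta>\<^sup>2)) + ennreal (K / B)"
      by (intro add_mono U X)
    also have "\<dots> = ennreal (card F * (pi * \<delta>\<^sup>2) + K / B)"
      using B R by (intro ennreal_plus[symmetric]) (auto simp: K_def)
    finally show ?case by (simp add: F_def K_def)
  qed
qed

end

section \<open>Choice of the auxiliary radius and convergence in measure\<close>

lemma eventually_le_of_enat_limit:
  assumes "(\<lambda>k. enat (N k)) \<longlonglongrightarrow> L" "enat n \<le> L"
  shows "eventually (\<lambda>k. n \<le> N k) sequentially"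
proof (cases n)
  case (Suc m)
  hence "enat m < L" using assms(2) by (metis Suc_ile_eq)
  from order_tendstoD(1)[OF assms(1) this] show ?thesis
    by eventually_elim (simp add: Suc)
qed simp

text \<open>The distances from \<open>z0\<close> to the finitely many points in the closed disc of radius \<open>R + 1\<close> leave a
  gap just above \<open>R\<close>.\<close>
lemma isolating_radius:
  fixes A :: "complex set"
  assumes "finite (A \<inter> cball z0 (R + 1))" "A \<inter> sphere z0 R = {}"
  obtains r where "r > R" "A \<inter> cball z0 r = A \<inter> ball z0 R"
proof -
  define G where "G = insert (R + 1) (dist z0 ` (A \<inter> cball z0 (R + 1)) \<inter> {R<..})"
  have G: "finite G" "G \<noteq> {}" using assms(1) by (auto simp: G_def)
  have "Min G \<in> G" by (rule Min_in[OF G])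
  hence m: "Min G > R" by (auto simp: G_def)
  define r where "r = (R + Min G) / 2"
  have r: "r > R" "r < Min G" using m by (auto simp: r_def)
  have "r < R + 1" using r(2) Min_le[OF G(1), of "R + 1"] by (simp add: G_def)
  have "dist z0 l < R" if l: "l \<in> A" "dist z0 l \<le> r" for l
  proof (rule ccontr)
    assume "\<not> dist z0 l < R"
    moreover have "dist z0 l \<noteq> R" using assms(2) l by auto
    ultimately have "dist z0 l \<in> G" using l \<open>r < R + 1\<close> by (auto simp: G_def)
    thus False using Min_le[OF G(1)] r(2) l(2) by fastforce
  qed
  hence "A \<inter> cball z0 r = A \<inter> ball z0 R" using r by auto
  with r(1) show ?thesis by (rule that)
qed

lemma filterlim_at_top_of_Suc_less:
  assumes "\<And>k. k \<ge> 1 \<Longrightarrow> M (k + 1) > (M k :: nat)"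
  shows "filterlim M at_top sequentially"
proof -
  have "k - 1 \<le> M k" for k
  proof (induction k)
    case (Suc k)
    thus ?case using assms[of k] by (cases k) auto
  qed simp
  moreover have "filterlim (\<lambda>k::nat. k - 1) at_top sequentially"
    by (rule filterlim_minus_const_nat_at_top)
  ultimately show ?thesis by (auto intro: filterlim_at_top_mono)
qed

lemma power_decay_bounded:
  assumes M: "filterlim M at_top sequentially" and q: "0 \<le> q" "q < (1::real)"
    and b: "b \<ge> 1" and N: "eventually (\<lambda>k. N k \<le> n) sequentially"
  shows "(\<lambda>k. q ^ M k * b ^ N k) \<longlonglongrightarrow> 0"
proof (rule Lim_null_comparison)
  show "eventually (\<lambda>k. norm (q ^ M k * b ^ N k) \<le> q ^ M k * b ^ n) sequentially"
    using N by eventually_elim (use q b in \<open>auto simp: abs_mult intro!: mult_left_mono power_increasing\<close>)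
  have "(\<lambda>m. q ^ m) \<longlonglongrightarrow> 0" using q by (intro LIMSEQ_power_zero) simp
  from tendsto_mult_left_zero[OF filterlim_compose[OF this M]]
  show "(\<lambda>k. q ^ M k * b ^ n) \<longlonglongrightarrow> 0" .
qed

text \<open>For exponents \<open>N\<close> as large as \<open>M + 1\<close> the geometric factor must beat \<open>b\<close>.\<close>
lemma power_decay_unbounded:
  assumes M: "filterlim M at_top sequentially" and q: "0 \<le> q" and b: "b \<ge> (1::real)" and qb: "q * b < 1"
    and N: "eventually (\<lambda>k. N k \<le> Suc (M k)) sequentially"
  shows "(\<lambda>k. q ^ M k * b ^ N k) \<longlonglongrightarrow> 0"
proof (rule Lim_null_comparison)
  show "eventually (\<lambda>k. norm (q ^ M k * b ^ N k) \<le> (q * b) ^ M k * b) sequentially"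
    using N
  proof eventually_elim
    case (elim k)
    have "q ^ M k * b ^ N k \<le> q ^ M k * b ^ Suc (M k)"
      using q b elim by (intro mult_left_mono power_increasing) auto
    thus ?case using q b by (simp add: power_mult_distrib abs_mult mult_ac)
  qed
  have "(\<lambda>m. (q * b) ^ m) \<longlonglongrightarrow> 0" using q b qb by (intro LIMSEQ_power_zero) simp
  from tendsto_mult_left_zero[OF filterlim_compose[OF this M]]
  show "(\<lambda>k. (q * b) ^ M k * b) \<longlonglongrightarrow> 0" .
qed

theorem theorem6p3:
  fixes D :: "'a::complex_hilbert_space set"
    and L :: "'a \<Rightarrow> 'a" and vstar :: 'a
    and S :: "complex \<Rightarrow> 'a"
    and z0 :: complex and R \<epsilon> :: real
    and Nbar :: nat and M N :: "nat \<Rightarrow> nat" and Nlim :: enat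
    and Q :: "nat \<Rightarrow> complex \<Rightarrow> complex"
  assumes separable: "separable_space (euclidean :: 'a topology)"
    and linear: "clinear_on D L"
    and dense: "closure D = UNIV"
    and bijective: "bij_betw L D UNIV"
    and inverse_compact: "compact_operator (inv_into D L)"
    and inverse_normal: "normal_operator (inv_into D L)"
    and S_def: "S = resolvent_map D L vstar"
    and spectrum_infinite: "infinite (op_spectrum D L)"
    and proj_nonzero:
      "\<And>l. l \<in> op_spectrum D L \<Longrightarrow> orth_proj (eigenspace D L l) vstar \<noteq> 0"
    and z0: "z0 \<notin> op_spectrum D L"
    and R_pos: "R > 0"
    and no_pole_boundary: "\<And>z. z \<in> sphere z0 R \<Longrightarrow> \<not> is_pole S z"
    and Nbar_def: "Nbar = card {z \<in> ball z0 R. is_pole S z}"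
    and M_ge: "\<And>k. k \<ge> 1 \<Longrightarrow> int (M k) \<ge> int (N k) - 1"
    and M_increasing: "\<And>k. k \<ge> 1 \<Longrightarrow> M (k + 1) > M k"
    and N_mono: "\<And>k. k \<ge> 1 \<Longrightarrow> N (k + 1) \<ge> N k"
    and N_limit: "(\<lambda>k. enat (N k)) \<longlonglongrightarrow> Nlim"
    and Nlim_ge: "Nlim \<ge> enat Nbar"
    and denominators:
      "\<And>k. k \<ge> 1 \<Longrightarrow> fast_LS_Pade_denominator S z0 (M k) (N k) (max (M k) (N k)) (Q k)"
    and eps_pos: "\<epsilon> > 0"
  shows "(\<lambda>k. emeasure lebesgue
            {z \<in> ball z0 R. z \<notin> op_spectrum D L \<and> Q k z \<noteq> 0 \<and>
               norm (S z - fast_LS_Pade S z0 (M k) (Q k) z) > \<epsilon>}) \<longlonglongrightarrow> 0"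
proof -
  define T where "T = inv_into D L"
  interpret compact_normal_operator T
    unfolding T_def by unfold_locales (rule inverse_compact, rule inverse_normal)
  have spec: "op_spectrum D L = char_values T"
    unfolding T_def by (rule op_spectrum_eq[OF linear bijective])
  have eig: "eigenspace D L l = {x. x = l *\<^sub>C T x}" for l
    unfolding T_def by (rule eigenspace_eq[OF linear bijective])
  have S: "S z = inv_resolvent T z vstar" if "z \<notin> char_values T" for z
    unfolding S_def T_def
    by (rule resolvent_map_eq[OF linear bijective compact_normal_operator_axioms[unfolded T_def]])
       (use that in \<open>simp add: T_def\<close>)
  have pole: "is_pole S l \<longleftrightarrow> l \<in> char_values T" for l
    by (rule is_pole_resolvent_iff[OF S]) (use proj_nonzero[of l] in \<open>auto simp: spec eig\<close>)
  have Nbar: "Nbar = card (char_values T \<inter> ball z0 R)"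
    unfolding Nbar_def pole by (rule arg_cong[of _ _ card]) auto
  have M_top: "filterlim M at_top sequentially"
    by (rule filterlim_at_top_of_Suc_less[of M, OF M_increasing])
  have NM: "eventually (\<lambda>k. N k \<le> Suc (M k)) sequentially"
    using eventually_ge_at_top[of 1] by eventually_elim (use M_ge in fastforce)
  have Q: "eventually (\<lambda>k. fast_LS_Pade_denominator S z0 (M k) (N k) (max (M k) (N k)) (Q k)) sequentially"
    using eventually_ge_at_top[of 1] by eventually_elim (rule denominators)
  have radius: "\<exists>r>R. eventually (\<lambda>k. card (char_values T \<inter> cball z0 r) \<le> N k) sequentially \<and>
      (\<lambda>k. (R / r) ^ M k * (2 * B) ^ N k) \<longlonglongrightarrow> 0" if B: "B \<ge> 1" for B
  proof (cases Nlim)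
    case (enat n)
    have "char_values T \<inter> sphere z0 R = {}" using no_pole_boundary pole by blast
    from isolating_radius[OF finite_char_values_cball this] obtain r
      where r: "r > R" "char_values T \<inter> cball z0 r = char_values T \<inter> ball z0 R" by blast
    have "eventually (\<lambda>k. card (char_values T \<inter> cball z0 r) \<le> N k) sequentially"
      unfolding r(2) Nbar[symmetric] by (rule eventually_le_of_enat_limit[OF N_limit Nlim_ge])
    moreover have "eventually (\<lambda>k. N k \<le> n) sequentially"
      using order_tendstoD(2)[OF N_limit, of "enat (Suc n)"] unfolding enat
      by (auto elim: eventually_mono)
    hence "(\<lambda>k. (R / r) ^ M k * (2 * B) ^ N k) \<longlonglongrightarrow> 0"
      using R_pos r(1) B by (intro power_decay_bounded[OF M_top]) auto
    ultimately show ?thesis using r(1) by blast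
  next
    case infinity
    \<comment> \<open>The factor 4 makes \<open>(R / r) (2 B) = 1/2\<close>.\<close>
    define r where "r = 4 * B * R"
    have r: "r > R" using B R_pos by (simp add: r_def)
    have "eventually (\<lambda>k. card (char_values T \<inter> cball z0 r) \<le> N k) sequentially"
      by (rule eventually_le_of_enat_limit[OF N_limit]) (simp add: infinity)
    moreover have "(\<lambda>k. (R / r) ^ M k * (2 * B) ^ N k) \<longlonglongrightarrow> 0"
      using R_pos B by (intro power_decay_unbounded[OF M_top _ _ _ NM]) (auto simp: r_def)
    ultimately show ?thesis using r by blast
  qed
  define f where "f k = emeasure lebesgue
            {z \<in> ball z0 R. z \<notin> op_spectrum D L \<and> Q k z \<noteq> 0 \<and>
               norm (S z - fast_LS_Pade S z0 (M k) (Q k) z) > \<epsilon>}" for k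
  have small: "eventually (\<lambda>k. f k \<le> ennreal \<tau>) sequentially" if \<tau>: "\<tau> > 0" for \<tau>
  proof -
    define K where "K = pi * R\<^sup>2 + (1 + R) * (pi * R\<^sup>2 + 4 * pi)"
    define c where "c = real (card (char_values T \<inter> cball z0 R))"
    define B where "B = max 1 (2 * K / \<tau>)"
    \<comment> \<open>The discs of radius \<open>\<delta>\<close> around the \<open>c\<close> poles have total area at most \<open>\<tau> / 2\<close>; adding one to
      \<open>c\<close> avoids a division by zero if there are no poles.\<close>
    define \<delta> where "\<delta> = sqrt (\<tau> / (2 * pi * (c + 1)))"
    have B: "B \<ge> 1" "K / B \<le> \<tau> / 2"
    proof -
      have "2 * K / \<tau> \<le> B" by (simp add: B_def)
      moreover show "B \<ge> 1" by (simp add: B_def)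
      ultimately show "K / B \<le> \<tau> / 2" using \<tau> by (simp add: field_simps)
    qed
    have c0: "c \<ge> 0" by (simp add: c_def)
    have \<delta>0: "\<delta> > 0" using \<tau> c0 by (simp add: \<delta>_def)
    have "c * (pi * \<delta>\<^sup>2) = \<tau> / 2 * (c / (c + 1))" using \<tau> c0 by (simp add: \<delta>_def)
    also have "\<dots> \<le> \<tau> / 2 * 1" using \<tau> c0 by (intro mult_left_mono) auto
    finally have \<delta>: "c * (pi * \<delta>\<^sup>2) \<le> \<tau> / 2" by simp
    obtain r where r: "r > R" "eventually (\<lambda>k. card (char_values T \<inter> cball z0 r) \<le> N k) sequentially"
      "(\<lambda>k. (R / r) ^ M k * (2 * B) ^ N k) \<longlonglongrightarrow> 0" using radius[OF B(1)] by blast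
    have "ennreal (c * (pi * \<delta>\<^sup>2) + K / B) \<le> ennreal \<tau>"
      using add_mono[OF \<delta> B(2)] by (intro ennreal_leI) simp
    moreover have "eventually (\<lambda>k. f k \<le> ennreal (c * (pi * \<delta>\<^sup>2) + K / B)) sequentially"
      unfolding f_def spec c_def K_def
      by (rule error_set_measure_bound[OF z0[unfolded spec] S R_pos r(1) \<delta>0 B(1) eps_pos NM r(2) Q r(3)])
    ultimately show ?thesis by (auto elim: eventually_mono intro: order_trans)
  qed
  have "f \<longlonglongrightarrow> 0"
  proof (rule order_tendstoI)
    fix a :: ennreal assume "0 < a"
    then obtain b where b: "0 < b" "b < a" using dense_order_class.dense by blast
    hence "b \<noteq> top" using top_greatest leD by blast
    then obtain \<tau> where "b = ennreal \<tau>" "\<tau> > 0" using b(1) by (cases b) auto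
    thus "eventually (\<lambda>k. f k < a) sequentially"
      using small[of \<tau>] b(2) by (auto elim: eventually_mono)
  qed simp
  thus ?thesis unfolding f_def .
qed

end
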